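(* For every partition $\lambda$, $$G_\lambda=\sum_{\gamma:\ \lambda(\gamma)=\lambda}\mathcal{L}_\gamma ,$$ where the sum is over all weak compositions $\gamma$ whose parts rearrange to $\lambda$ (an identity of formal power series in $x_1,x_2,\dots$ with coefficients in $\mathbb{Z}[\beta]$).
   Context: $\beta$ is an indeterminate. A weak composition $\gamma=(\gamma_1,\dots,\gamma_n)$ is a finite sequence of nonnegative integers; weak compositions differing only by trailing zeros are identified, and likewise for partitions. $|\gamma|=\sum_i\gamma_i$. A partition is a weak composition with weakly decreasing parts; $\lambda(\gamma)$ is the unique partition with the same parts as $\gamma$. Skyline diagrams. The skyline diagram of $\gamma$ has left-justified rows numbered $1,\dots,n$ from top to bottom, with boxes $(i,j)$, $1\le j\le\gamma_i$, in row $i$, plus a basement box $(i,0)$ in each row containing the fixed value $b_i=i$. A set-valued filling assigns a nonempty finite set of positive integers to each non-basement box. The maximum of a box is its anchor entry; the other entries of the box are free entries. A basement box is treated as a box with the single (anchor) entry $i$. Triples, for rows $i<j$ and a column $k\ge0$. Type A (when $\gamma_i\ge\gamma_j$): the boxes $(i,k),(i,k+1),(j,k+1)$, with anchor entries $c,a,b$ respectively. Type B (when $\gamma_i<\gamma_j$): the boxes $(i,k),(j,k),(j,k+1)$, with anchor entries $b,c,a$ respectively. (All three boxes must exist; basement boxes are allowed.) A triple is an inversion triple if $b>c\ge a$ or $c\ge a>b$. A set-valued filling is semistandard if: (S1) entries do not repeat in a column; (S2) rows, including the basement, are weakly decreasing from left to right, where for sets $A\ge B$ means $\min A\ge\max B$;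 (S3) every triple of anchor entries (including basement boxes) is an inversion triple; (S4) every free entry is in the highest (lowest-numbered) row possible within its column: a free entry $x$ in column $j$ lies in the smallest-numbered row $i$ such that the box $(i,j)$ exists, $x$ is smaller than the anchor entry of $(i,j)$ (so $x$ is free there), and placing $x$ there does not violate (S2), i.e. $x$ is at least the anchor entry of $(i,j+1)$ if that box exists. $\mathsf{SetSkyFill}(\gamma)$ is the set of semistandard set-valued fillings of shape $\gamma$ with basement $b_i=i$. For such $F$, $|F|$ is the total number of entries (not counting the basement) and $x^F=\prod_i x_i^{m_i}$, where $m_i$ is the number of occurrences of $i$ in $F$ outside the basement. The combinatorial Lascoux atom is $$\mathcal{L}_\gamma=\sum_{F\in\mathsf{SetSkyFill}(\gamma)}\beta^{|F|-|\gamma|}x^F\in\mathbb{Z}[\beta][x_1,\dots,x_n].$$ Symmetric Grothendieck function. A set-valued reverse tableau of shape $\lambda$ is a filling of the Young diagram of $\lambda$ (English notation) by nonempty finite sets of positive integers such that rows are weakly decreasing from left to right ($\min A\ge\max B$ for $B$ immediately right of $A$) and columns are strictly decreasing from top to bottom ($\min A>\max B$ for $B$ immediately below $A$). $\mathsf{SetRT}(\lambda)$ is the set of these. For $T\in\mathsf{SetRT}(\lambda)$, $|T|$ is the total number of entries, $x^T=\prod_i x_i^{\#\{i\text{'s in }T\}}$, and $G_\lambda=\sum_{T\in\mathsf{SetRT}(\lambda)}\beta^{|T|-|\lambda|}x^T$. *)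

theory Defs
  imports "HOL-Library.Poly_Mapping" "HOL-Computational_Algebra.Polynomial"
begin

abbreviation lookup :: "('a \<Rightarrow>\<^sub>0 'b::zero) \<Rightarrow> 'a \<Rightarrow> 'b" where
  "lookup \<equiv> Poly_Mapping.lookup"

abbreviation keys :: "('a \<Rightarrow>\<^sub>0 'b::zero) \<Rightarrow> 'a set" where
  "keys \<equiv> Poly_Mapping.keys"


section \<open>Polynomials and formal power series\<close>

text \<open>
  A monomial in \<open>x\<^sub>1, x\<^sub>2, \<dots>\<close> is its finitely supported exponent vector. Polynomials and formal
  power series over \<open>\<int>[\<beta>]\<close> are finitely supported, respectively arbitrary, functions from
  monomials to coefficients; \<open>lookup\<close> embeds the former in the latter.
\<close>

type_synonym monomial = "nat \<Rightarrow>\<^sub>0 nat"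
type_synonym mpoly_beta = "monomial \<Rightarrow>\<^sub>0 int poly"
type_synonym mseries_beta = "monomial \<Rightarrow> int poly"

definition beta :: "int poly" where
  "beta = [:0, 1:]"

text \<open>
  Infinite sums of power series are taken coefficientwise. They are meaningful when every monomial
  has nonzero coefficient in only finitely many summands.
\<close>

definition formally_summable :: "('a \<Rightarrow> mseries_beta) \<Rightarrow> 'a set \<Rightarrow> bool" where
  "formally_summable f A \<longleftrightarrow> (\<forall>m. finite {a \<in> A. f a m \<noteq> 0})"

definition formal_sum :: "('a \<Rightarrow> mseries_beta) \<Rightarrow> 'a set \<Rightarrow> mseries_beta" where
  "formal_sum f A = (\<lambda>m. \<Sum>a \<in> {a \<in> A. f a m \<noteq> 0}. f a m)"

definition has_formal_sum :: "('a \<Rightarrow> mseries_beta) \<Rightarrow> 'a set \<Rightarrow> mseries_beta \<Rightarrow> bool" where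
  "has_formal_sum f A s \<longleftrightarrow> formally_summable f A \<and> s = formal_sum f A"


section \<open>Weak compositions and partitions\<close>

text \<open>
  Identifying weak compositions that differ by trailing zeros amounts to viewing them as finitely
  supported functions. Indices start at 1, so the value at the unused index 0 is required to be 0.
  The infinitely many trailing zero rows have no boxes outside the basement and take part in no
  triple, so they impose no condition on fillings.
\<close>

definition weak_composition :: "(nat \<Rightarrow>\<^sub>0 nat) \<Rightarrow> bool" where
  "weak_composition \<gamma> \<longleftrightarrow> lookup \<gamma> 0 = 0"

definition is_partition :: "(nat \<Rightarrow>\<^sub>0 nat) \<Rightarrow> bool" where
  "is_partition \<mu> \<longleftrightarrow> weak_composition \<mu> \<and> (\<forall>i j. 1 \<le> i \<and> i \<le> j \<longrightarrow> lookup \<mu> j \<le> lookup \<mu> i)"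

definition comp_size :: "(nat \<Rightarrow>\<^sub>0 nat) \<Rightarrow> nat" where
  "comp_size \<gamma> = (\<Sum>i \<in> keys \<gamma>. lookup \<gamma> i)"

text \<open>The multiset of nonzero parts.\<close>

definition parts :: "(nat \<Rightarrow>\<^sub>0 nat) \<Rightarrow> nat multiset" where
  "parts \<gamma> = {#lookup \<gamma> i. i \<in># mset_set (keys \<gamma>)#}"

definition sort_composition :: "(nat \<Rightarrow>\<^sub>0 nat) \<Rightarrow> (nat \<Rightarrow>\<^sub>0 nat)" where
  "sort_composition \<gamma> = (THE \<mu>. is_partition \<mu> \<and> parts \<mu> = parts \<gamma>)"


section \<open>Set-valued fillings\<close>

text \<open>
  Boxes \<open>(i, j)\<close> are in row \<open>i\<close> and column \<open>j\<close>. For a partition these are the boxes of its Young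
  diagram in English notation.
\<close>

definition boxes :: "(nat \<Rightarrow>\<^sub>0 nat) \<Rightarrow> (nat \<times> nat) set" where
  "boxes \<gamma> = {(i, j). 1 \<le> i \<and> 1 \<le> j \<and> j \<le> lookup \<gamma> i}"

definition boxes_with_basement :: "(nat \<Rightarrow>\<^sub>0 nat) \<Rightarrow> (nat \<times> nat) set" where
  "boxes_with_basement \<gamma> = {(i, j). 1 \<le> i \<and> j \<le> lookup \<gamma> i}"

type_synonym filling = "nat \<Rightarrow> nat \<Rightarrow> nat set"

text \<open>
  The value of a filling is fixed to be empty outside the diagram, so that fillings of a given
  shape are counted once each.
\<close>

definition set_valued_filling :: "(nat \<Rightarrow>\<^sub>0 nat) \<Rightarrow> filling \<Rightarrow> bool" where
  "set_valued_filling \<gamma> F \<longleftrightarrow>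
     (\<forall>i j. (i, j) \<in> boxes \<gamma> \<longrightarrow> finite (F i j) \<and> F i j \<noteq> {} \<and> 0 \<notin> F i j) \<and>
     (\<forall>i j. (i, j) \<notin> boxes \<gamma> \<longrightarrow> F i j = {})"

definition num_entries :: "(nat \<Rightarrow>\<^sub>0 nat) \<Rightarrow> filling \<Rightarrow> nat" where
  "num_entries \<gamma> F = (\<Sum>(i, j) \<in> boxes \<gamma>. card (F i j))"

definition filling_content :: "(nat \<Rightarrow>\<^sub>0 nat) \<Rightarrow> filling \<Rightarrow> monomial" where
  "filling_content \<gamma> F = (\<Sum>(i, j) \<in> boxes \<gamma>. \<Sum>x \<in> F i j. Poly_Mapping.single x 1)"

text \<open>
  The monomial \<open>\<beta>\<^bsup>|F| - |\<gamma>|\<^esup> x\<^sup>F\<close>. The subtraction does not truncate, since every box is nonempty.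
\<close>

definition weight :: "(nat \<Rightarrow>\<^sub>0 nat) \<Rightarrow> filling \<Rightarrow> mpoly_beta" where
  "weight \<gamma> F = Poly_Mapping.single (filling_content \<gamma> F) (beta ^ (num_entries \<gamma> F - comp_size \<gamma>))"


section \<open>Semistandard skyline fillings and Lascoux atoms\<close>

definition with_basement :: "filling \<Rightarrow> filling" where
  "with_basement F i j = (if j = 0 then {i} else F i j)"

definition anchor :: "filling \<Rightarrow> nat \<Rightarrow> nat \<Rightarrow> nat" where
  "anchor F i j = Max (with_basement F i j)"

definition columns_distinct :: "filling \<Rightarrow> bool" where
  "columns_distinct F \<longleftrightarrow> (\<forall>i i' j. 1 \<le> j \<and> i \<noteq> i' \<longrightarrow> F i j \<inter> F i' j = {})"

definition rows_decreasing :: "(nat \<Rightarrow>\<^sub>0 nat) \<Rightarrow> filling \<Rightarrow> bool" where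
  "rows_decreasing \<gamma> F \<longleftrightarrow>
     (\<forall>i j. (i, j) \<in> boxes_with_basement \<gamma> \<and> (i, Suc j) \<in> boxes_with_basement \<gamma> \<longrightarrow>
        Min (with_basement F i j) \<ge> Max (with_basement F i (Suc j)))"

definition inversion_triple :: "nat \<Rightarrow> nat \<Rightarrow> nat \<Rightarrow> bool" where
  "inversion_triple a b c \<longleftrightarrow> (b > c \<and> c \<ge> a) \<or> (c \<ge> a \<and> a > b)"

definition type_A_triples_inverted :: "(nat \<Rightarrow>\<^sub>0 nat) \<Rightarrow> filling \<Rightarrow> bool" where
  "type_A_triples_inverted \<gamma> F \<longleftrightarrow>
     (\<forall>i j k. i < j \<and> lookup \<gamma> i \<ge> lookup \<gamma> j \<and>
        {(i, k), (i, Suc k), (j, Suc k)} \<subseteq> boxes_with_basement \<gamma> \<longrightarrow>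
        (let c = anchor F i k; a = anchor F i (Suc k); b = anchor F j (Suc k)
         in inversion_triple a b c))"

definition type_B_triples_inverted :: "(nat \<Rightarrow>\<^sub>0 nat) \<Rightarrow> filling \<Rightarrow> bool" where
  "type_B_triples_inverted \<gamma> F \<longleftrightarrow>
     (\<forall>i j k. i < j \<and> lookup \<gamma> i < lookup \<gamma> j \<and>
        {(i, k), (j, k), (j, Suc k)} \<subseteq> boxes_with_basement \<gamma> \<longrightarrow>
        (let b = anchor F i k; c = anchor F j k; a = anchor F j (Suc k)
         in inversion_triple a b c))"

definition free_position :: "(nat \<Rightarrow>\<^sub>0 nat) \<Rightarrow> filling \<Rightarrow> nat \<Rightarrow> nat \<Rightarrow> nat \<Rightarrow> bool" where
  "free_position \<gamma> F x j i \<longleftrightarrow>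
     (i, j) \<in> boxes \<gamma> \<and> x < anchor F i j \<and>
     ((i, Suc j) \<in> boxes \<gamma> \<longrightarrow> x \<ge> anchor F i (Suc j))"

definition free_entries_highest :: "(nat \<Rightarrow>\<^sub>0 nat) \<Rightarrow> filling \<Rightarrow> bool" where
  "free_entries_highest \<gamma> F \<longleftrightarrow>
     (\<forall>(i, j) \<in> boxes \<gamma>. \<forall>x \<in> F i j. x \<noteq> anchor F i j \<longrightarrow>
        free_position \<gamma> F x j i \<and> (\<forall>r. free_position \<gamma> F x j r \<longrightarrow> i \<le> r))"

definition SetSkyFill :: "(nat \<Rightarrow>\<^sub>0 nat) \<Rightarrow> filling set" where
  "SetSkyFill \<gamma> = {F. set_valued_filling \<gamma> F \<and> columns_distinct F \<and> rows_decreasing \<gamma> F \<and>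
     type_A_triples_inverted \<gamma> F \<and> type_B_triples_inverted \<gamma> F \<and> free_entries_highest \<gamma> F}"

definition lascoux_atom :: "(nat \<Rightarrow>\<^sub>0 nat) \<Rightarrow> mpoly_beta" where
  "lascoux_atom \<gamma> = (\<Sum>F \<in> SetSkyFill \<gamma>. weight \<gamma> F)"


section \<open>Set-valued reverse tableaux and symmetric Grothendieck functions\<close>

definition SetRT :: "(nat \<Rightarrow>\<^sub>0 nat) \<Rightarrow> filling set" where
  "SetRT \<mu> = {T. set_valued_filling \<mu> T \<and>
     (\<forall>i j. (i, j) \<in> boxes \<mu> \<and> (i, Suc j) \<in> boxes \<mu> \<longrightarrow> Min (T i j) \<ge> Max (T i (Suc j))) \<and>
     (\<forall>i j. (i, j) \<in> boxes \<mu> \<and> (Suc i, j) \<in> boxes \<mu> \<longrightarrow> Min (T i j) > Max (T (Suc i) j))}"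

definition symmetric_grothendieck :: "(nat \<Rightarrow>\<^sub>0 nat) \<Rightarrow> mseries_beta" where
  "symmetric_grothendieck \<mu> = formal_sum (\<lambda>T. lookup (weight \<mu> T)) (SetRT \<mu>)"


section \<open>The sums and the sorted partition are well defined\<close>

lemma finite_boxes: "finite (boxes \<gamma>)"
proof -
  have "boxes \<gamma> \<subseteq> (SIGMA i:keys \<gamma>. {..lookup \<gamma> i})"
    by (auto simp: boxes_def in_keys_iff)
  then show ?thesis
    by (rule finite_subset) auto
qed

lemma finite_fillings:
  assumes "finite X"
  shows "finite {F. set_valued_filling \<gamma> F \<and> (\<forall>i j. F i j \<subseteq> X)}" (is "finite ?S")
proof -
  let ?U = "{f. \<forall>p. (p \<in> boxes \<gamma> \<longrightarrow> f p \<in> Pow X) \<and> (p \<notin> boxes \<gamma> \<longrightarrow> f p = {})}"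
  have "finite ?U"
    by (rule finite_set_of_finite_funs) (use assms finite_boxes in auto)
  moreover have "?S \<subseteq> curry ` ?U"
  proof
    fix F assume F: "F \<in> ?S"
    have "\<forall>p. (p \<in> boxes \<gamma> \<longrightarrow> case_prod F p \<in> Pow X) \<and>
            (p \<notin> boxes \<gamma> \<longrightarrow> case_prod F p = {})"
      using F unfolding set_valued_filling_def split_paired_all by simp
    then have "case_prod F \<in> ?U"
      by blast
    then have "curry (case_prod F) \<in> curry ` ?U"
      by (rule imageI)
    then show "F \<in> curry ` ?U"
      by (simp only: curry_case_prod)
  qed
  ultimately show ?thesis
    by (meson finite_imageI finite_subset)
qed

lemma finite_SetSkyFill: "finite (SetSkyFill \<gamma>)"
proof -
  have *: "x \<le> i"
    if F: "set_valued_filling \<gamma> F" "rows_decreasing \<gamma> F" and x: "(i, j) \<in> boxes \<gamma>" "x \<in> F i j"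
    for F i j x
    using x
  proof (induction j arbitrary: x)
    case 0
    then show ?case by (simp add: boxes_def)
  next
    case (Suc j)
    have fin: "finite (F i (Suc j))"
      using F(1) Suc.prems by (auto simp: set_valued_filling_def)
    have "Min (with_basement F i j) \<ge> Max (with_basement F i (Suc j))"
      using F(2) Suc.prems by (auto simp: rows_decreasing_def boxes_with_basement_def boxes_def)
    moreover have "Max (with_basement F i (Suc j)) \<ge> x"
      using fin Suc.prems(2) by (simp add: with_basement_def)
    ultimately have le: "Min (with_basement F i j) \<ge> x"
      by linarith
    show ?case
    proof (cases "j = 0")
      case True
      then show ?thesis using le by (simp add: with_basement_def)
    next
      case False
      then have b: "(i, j) \<in> boxes \<gamma>"
        using Suc.prems by (auto simp: boxes_def)
      then have "finite (F i j)" "F i j \<noteq> {}"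
        using F(1) by (auto simp: set_valued_filling_def)
      then have "Min (F i j) \<in> F i j"
        by simp
      then show ?thesis
        using Suc.IH[OF b] le False by (force simp: with_basement_def)
    qed
  qed
  have "SetSkyFill \<gamma> \<subseteq> {F. set_valued_filling \<gamma> F \<and> (\<forall>i j. F i j \<subseteq> (\<Union>i\<in>keys \<gamma>. {..i}))}"
  proof (intro subsetI CollectI conjI allI)
    fix F i j x assume F: "F \<in> SetSkyFill \<gamma>" and x: "x \<in> F i j"
    have b: "(i, j) \<in> boxes \<gamma>"
      using F x unfolding SetSkyFill_def set_valued_filling_def by blast
    then have "i \<in> keys \<gamma>"
      by (auto simp: boxes_def in_keys_iff)
    moreover have "x \<le> i"
      using *[of F i j x] F b x by (auto simp: SetSkyFill_def)
    ultimately show "x \<in> (\<Union>i\<in>keys \<gamma>. {..i})"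
      by auto
  qed (simp add: SetSkyFill_def)
  then show ?thesis
    by (rule finite_subset) (intro finite_fillings, simp)
qed

lemma entries_subset_keys_content:
  assumes "set_valued_filling \<gamma> F"
  shows "F i j \<subseteq> keys (filling_content \<gamma> F)"
proof
  fix x assume x: "x \<in> F i j"
  then have b: "(i, j) \<in> boxes \<gamma>"
    using assms unfolding set_valued_filling_def by blast
  then have fin: "finite (F i j)"
    using assms by (auto simp: set_valued_filling_def)
  have "1 \<le> (\<Sum>y\<in>F i j. lookup (Poly_Mapping.single y (1::nat)) x)"
    using member_le_sum[OF x, of "\<lambda>y. lookup (Poly_Mapping.single y (1::nat)) x"] fin by simp
  also have "\<dots> \<le> (\<Sum>p\<in>boxes \<gamma>. \<Sum>y\<in>F (fst p) (snd p). lookup (Poly_Mapping.single y (1::nat)) x)"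
    using member_le_sum[OF b,
        of "\<lambda>p. \<Sum>y\<in>F (fst p) (snd p). lookup (Poly_Mapping.single y (1::nat)) x"] finite_boxes
    by simp
  also have "\<dots> = lookup (filling_content \<gamma> F) x"
    by (simp add: filling_content_def lookup_sum case_prod_beta)
  finally show "x \<in> keys (filling_content \<gamma> F)"
    by (simp add: in_keys_iff)
qed

lemma formally_summable_SetRT: "formally_summable (\<lambda>T. lookup (weight \<mu> T)) (SetRT \<mu>)"
  unfolding formally_summable_def
proof
  fix m :: monomial
  have "{T \<in> SetRT \<mu>. lookup (weight \<mu> T) m \<noteq> 0}
          \<subseteq> {F. set_valued_filling \<mu> F \<and> (\<forall>i j. F i j \<subseteq> keys m)}"
  proof
    fix T assume T: "T \<in> {T \<in> SetRT \<mu>. lookup (weight \<mu> T) m \<noteq> 0}"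
    then have "filling_content \<mu> T = m"
      by (auto simp: weight_def lookup_single when_def split: if_splits)
    then show "T \<in> {F. set_valued_filling \<mu> F \<and> (\<forall>i j. F i j \<subseteq> keys m)}"
      using T entries_subset_keys_content[of \<mu> T] by (auto simp: SetRT_def)
  qed
  then show "finite {T \<in> SetRT \<mu>. lookup (weight \<mu> T) m \<noteq> 0}"
    by (rule finite_subset) (intro finite_fillings, simp)
qed

lemma has_formal_sum_symmetric_grothendieck:
  "has_formal_sum (\<lambda>T. lookup (weight \<mu> T)) (SetRT \<mu>) (symmetric_grothendieck \<mu>)"
  by (simp add: has_formal_sum_def formally_summable_SetRT symmetric_grothendieck_def)

lemma card_large_parts:
  assumes "1 \<le> p"
  shows "card {i. p \<le> lookup \<gamma> i} = size (filter_mset (\<lambda>q. p \<le> q) (parts \<gamma>))"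
proof -
  have "{i. p \<le> lookup \<gamma> i} = {i \<in> keys \<gamma>. p \<le> lookup \<gamma> i}"
    using assms by (auto simp: in_keys_iff)
  then show ?thesis
    by (simp add: parts_def filter_mset_image_mset)
qed

lemma partition_large_parts:
  assumes "is_partition \<mu>" "1 \<le> p"
  shows "{i. p \<le> lookup \<mu> i} = {1..card {i. p \<le> lookup \<mu> i}}"
proof -
  let ?A = "{i. p \<le> lookup \<mu> i}"
  have "?A \<subseteq> keys \<mu>"
    using assms by (auto simp: in_keys_iff)
  then have fin: "finite ?A"
    by (rule finite_subset) simp
  have pos: "1 \<le> i" if "i \<in> ?A" for i
    using that assms by (cases i) (auto simp: is_partition_def weak_composition_def)
  have down: "i \<in> ?A" if "1 \<le> i" "i \<le> j" "j \<in> ?A" for i j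
    using that assms by (fastforce simp: is_partition_def)
  have "\<exists>n. ?A = {1..n}"
  proof (cases "?A = {}")
    case True
    then have "?A = {1..0}" by simp
    then show ?thesis by blast
  next
    case False
    then have "?A = {1..Max ?A}"
      using fin pos down Max_in[OF fin False] Max_ge[OF fin] by (metis (no_types, lifting)
          atLeastAtMost_iff subsetI subset_antisym)
    then show ?thesis by blast
  qed
  then show ?thesis
    by (metis card_atLeastAtMost diff_Suc_1)
qed

lemma partition_eqI:
  assumes "is_partition \<mu>" "is_partition \<nu>" "parts \<mu> = parts \<nu>"
  shows "\<mu> = \<nu>"
proof (rule poly_mapping_eqI)
  fix i
  have eq: "{i. p \<le> lookup \<mu> i} = {i. p \<le> lookup \<nu> i}" if "1 \<le> p" for p
    using partition_large_parts[OF assms(1) that] partition_large_parts[OF assms(2) that]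
      card_large_parts[OF that, of \<mu>] card_large_parts[OF that, of \<nu>] assms(3) by simp
  have le: "p \<le> lookup \<mu> i \<longleftrightarrow> p \<le> lookup \<nu> i" for p
    using eq[of p] by (cases "p = 0") auto
  show "lookup \<mu> i = lookup \<nu> i"
    using le[of "lookup \<mu> i"] le[of "lookup \<nu> i"] by simp
qed

lemma ex1_partition_same_parts: "\<exists>!\<mu>. is_partition \<mu> \<and> parts \<mu> = parts \<gamma>"
proof (rule ex_ex1I)
  define xs where "xs = rev (sorted_list_of_multiset (parts \<gamma>))"
  have mset_xs: "mset xs = parts \<gamma>"
    by (simp add: xs_def)
  have "x > 0" if "x \<in># parts \<gamma>" for x
    using that by (auto simp: parts_def in_keys_iff)
  then have xs_pos: "x > 0" if "x \<in> set xs" for x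
    using that mset_xs by (metis set_mset_mset)
  have anti: "xs ! j \<le> xs ! i" if "i \<le> j" "j < length xs" for i j
    using that sorted_rev_nth_mono[of xs i j] by (simp add: xs_def)
  define \<mu> where "\<mu> = Poly_Mapping.nth (0 # xs)"
  have look: "lookup \<mu> i = (if 1 \<le> i \<and> i \<le> length xs then xs ! (i - 1) else 0)" for i
    by (cases i) (auto simp: \<mu>_def nth.rep_eq nth_default_def)
  have keys: "keys \<mu> = Suc ` {..<length xs}"
  proof (intro equalityI subsetI)
    fix i assume "i \<in> keys \<mu>"
    then have "1 \<le> i" "i \<le> length xs"
      by (auto simp: in_keys_iff look split: if_splits)
    then show "i \<in> Suc ` {..<length xs}"
      by (cases i) auto
  next
    fix i assume "i \<in> Suc ` {..<length xs}"
    then show "i \<in> keys \<mu>"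
      using xs_pos by (force simp: in_keys_iff look)
  qed
  have "lookup \<mu> j \<le> lookup \<mu> i" if "1 \<le> i" "i \<le> j" for i j
    using that anti[of "i - 1" "j - 1"] by (simp add: look)
  then have "is_partition \<mu>"
    by (simp add: is_partition_def weak_composition_def look)
  moreover have "parts \<mu> = parts \<gamma>"
  proof -
    have "parts \<mu> = image_mset (lookup \<mu>) (image_mset Suc (mset_set {..<length xs}))"
      by (simp add: parts_def keys image_mset_mset_set)
    also have "\<dots> = image_mset ((!) xs) (mset_set {..<length xs})"
      unfolding multiset.map_comp by (intro image_mset_cong) (auto simp: look)
    also have "\<dots> = image_mset ((!) xs) (mset [0..<length xs])"
      by (metis mset_upt lessThan_atLeast0)
    also have "\<dots> = mset xs"
      by (metis map_nth mset_map)
    finally show ?thesis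
      using mset_xs by simp
  qed
  ultimately show "\<exists>\<mu>. is_partition \<mu> \<and> parts \<mu> = parts \<gamma>"
    by blast
next
  fix \<mu> \<nu>
  assume "is_partition \<mu> \<and> parts \<mu> = parts \<gamma>" "is_partition \<nu> \<and> parts \<nu> = parts \<gamma>"
  then show "\<mu> = \<nu>"
    by (intro partition_eqI) simp_all
qed

end

theory Submission
  imports Defs
begin

text \<open>
  Record a filling by two sets per column: the set \<open>A j\<close> of anchor entries and the set \<open>B j\<close> of free
  entries. Both kinds of fillings are determined by this data, and the admissible data are the same,
  which gives a bijection preserving the content.

  For the anchors this is Mason's bijection. A reverse tableau sorts each \<open>A j\<close>. For skyline fillings,
  the triple conditions over all columns are equivalent to a condition on pairs of consecutive
  columns, saying that column \<open>j + 1\<close> arises from column \<open>j\<close> by placing the elements of \<open>A (j + 1)\<close>,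
  largest first, in the highest free row whose entry in column \<open>j\<close> is not smaller. In both cases
  the rows can be weakly decreasing exactly if, for every \<open>x\<close>, at least as many anchors of column \<open>j\<close>
  as of column \<open>j + 1\<close> exceed \<open>x\<close>.

  A free entry \<open>x\<close> fits in the rows whose anchor exceeds \<open>x\<close> in column \<open>j\<close> but not in column
  \<open>j + 1\<close>. Such a row exists iff strictly more anchors of column \<open>j\<close> than of column \<open>j + 1\<close> exceed
  \<open>x\<close>, which depends on the column sets only. A skyline filling puts \<open>x\<close> in the first of these rows,
  a reverse tableau is forced to put it in the last one.
\<close>

section \<open>Placing the anchors of a single column\<close>

text \<open>A column of a reverse tableau, read as a function of the row. The value 0 marks a
  missing box and, from row 1 on, can only be followed by missing boxes. Row 0 is outside every
  diagram and is pinned to 0.\<close>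

definition column_ordered :: "(nat \<Rightarrow> nat) \<Rightarrow> bool" where
  "column_ordered f \<longleftrightarrow> f 0 = 0 \<and> (\<forall>i\<ge>1. f (Suc i) < f i \<or> f (Suc i) = 0)"

lemma down_closed_interval:
  assumes "finite S" "0 \<notin> S" "\<And>i. 1 \<le> i \<Longrightarrow> Suc i \<in> S \<Longrightarrow> i \<in> S"
  shows "S = {1..card S}"
proof -
  have down: "i \<in> S" if "j \<in> S" "1 \<le> i" "i \<le> j" for i j
    using that(3,1,2)
  proof (induction j rule: dec_induct)
    case (step n)
    then show ?case
      using assms(3)[of n] by simp
  qed simp
  have "\<exists>n. S = {1..n}"
  proof (cases "S = {}")
    case True
    then have "S = {1..0}" by simp
    then show ?thesis by blast
  next
    case False
    have "S = {1..Max S}"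
    proof (intro equalityI subsetI)
      fix i assume "i \<in> S"
      then show "i \<in> {1..Max S}"
        using assms(1,2) by (cases "i = 0") simp_all
    next
      fix i assume "i \<in> {1..Max S}"
      then show "i \<in> S"
        using down[of "Max S" i] Max_in[OF assms(1) False] by simp
    qed
    then show ?thesis by blast
  qed
  then obtain n where "S = {1..n}" ..
  then show ?thesis by simp
qed

lemma column_ordered_less:
  assumes f: "column_ordered f" and "1 \<le> i" and "i < j" "0 < f j"
  shows "f j < f i"
  using assms(3,4)
proof (induction j)
  case (Suc j)
  then have "1 \<le> j"
    using \<open>1 \<le> i\<close> by simp
  then have "f (Suc j) < f j"
    using f Suc.prems by (auto simp: column_ordered_def)
  then show ?case
    using Suc by (cases "i = j") auto
qed simp

lemma column_ordered_inj:
  assumes f: "column_ordered f"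
  shows "inj_on f {i. 0 < f i}"
proof (rule linorder_inj_onI')
  fix i j assume ij: "i \<in> {i. 0 < f i}" "j \<in> {i. 0 < f i}" "i < j"
  then have "1 \<le> i"
    using f by (cases i) (auto simp: column_ordered_def)
  then show "f i \<noteq> f j"
    using column_ordered_less[OF f, of i j] ij by simp
qed

text \<open>The rows with entry at least \<open>x\<close> form an initial segment on which
  \<open>f\<close> is injective, so its length is a count in the set of entries. Hence that set
  determines the column, and entries of different columns can be compared by comparing
  counts.\<close>

lemma column_ordered_threshold:
  assumes f: "column_ordered f" and fin: "finite {i. 0 < f i}" and x: "1 \<le> x"
  shows "x \<le> f i \<longleftrightarrow> 1 \<le> i \<and> i \<le> card {a \<in> range f - {0}. x \<le> a}"
proof -
  let ?S = "{i. x \<le> f i}"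
  have "?S \<subseteq> {i. 0 < f i}"
    using x by auto
  then have S: "finite ?S"
    using fin by (rule finite_subset)
  have "?S = {1..card ?S}"
  proof (rule down_closed_interval[OF S])
    show "0 \<notin> ?S"
      using f x by (simp add: column_ordered_def)
    fix i :: nat assume "1 \<le> i" "Suc i \<in> ?S"
    then show "i \<in> ?S"
      using column_ordered_less[OF f, of i "Suc i"] x by simp
  qed
  moreover have "{a \<in> range f - {0}. x \<le> a} = f ` ?S"
    using x by auto
  moreover have "inj_on f ?S"
    by (rule inj_on_subset[OF column_ordered_inj[OF f]]) (use x in auto)
  ultimately show ?thesis
    by (simp add: card_image) (metis (mono_tags, lifting) atLeastAtMost_iff mem_Collect_eq)
qed

lemma column_ordered_exists:
  assumes "finite C" "0 \<notin> C"
  shows "\<exists>f. column_ordered f \<and> finite {i. 0 < f i} \<and> range f - {0} = C"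
  using assms
proof (induction C rule: finite_linorder_min_induct)
  case empty
  show ?case by (rule exI[of _ "\<lambda>_. 0"]) (auto simp: column_ordered_def)
next
  case (insert b C)
  then obtain f where f: "column_ordered f" and fin: "finite {i. 0 < f i}" and C: "range f - {0} = C"
    by auto
  have pos: "0 < f i \<longleftrightarrow> 1 \<le> i \<and> i \<le> card C" for i
  proof -
    have "{a \<in> range f - {0}. 1 \<le> a} = C" using C by auto
    then show ?thesis
      using column_ordered_threshold[OF f fin, of 1 i] by (simp add: Suc_le_eq)
  qed
  \<comment> \<open>The induction adds the smallest element last, so it goes directly below the
    \<open>card C\<close> occupied rows.\<close>
  define g where "g = f(Suc (card C) := b)"
  have gt: "b < f i" if "1 \<le> i" "i \<le> card C" for i
    using that pos[of i] insert.hyps C by auto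
  have z: "f (Suc (card C)) = 0"
    using pos[of "Suc (card C)"] by simp
  have "column_ordered g"
    unfolding column_ordered_def g_def
    using f gt pos by (auto simp: column_ordered_def)
  moreover have "range g - {0} = insert b C"
  proof -
    have "range g = insert b (f ` (- {Suc (card C)}))"
      by (auto simp: g_def)
    moreover have "f ` (- {Suc (card C)}) - {0} = C"
    proof -
      have "range f = insert 0 (f ` (- {Suc (card C)}))"
        using z by (metis Compl_insert image_insert insert_UNIV insert_Diff_single Compl_eq_Diff_UNIV)
      then show ?thesis using C by auto
    qed
    ultimately show ?thesis
      using insert.prems by auto
  qed
  moreover have "finite {i. 0 < g i}"
    by (rule finite_subset[of _ "insert (Suc (card C)) {i. 0 < f i}"]) (use fin in \<open>auto simp: g_def\<close>)
  ultimately show ?case by blast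
qed

text \<open>
  Column \<open>g\<close> results from column \<open>f\<close> by the greedy placement; the value 0 stands for a missing box.
\<close>

definition placed_below :: "(nat \<Rightarrow> nat) \<Rightarrow> (nat \<Rightarrow> nat) \<Rightarrow> bool" where
  "placed_below f g \<longleftrightarrow> (\<forall>i. g i \<le> f i) \<and> inj_on g {i. 0 < g i} \<and>
     (\<forall>i j. i < j \<and> 0 < g j \<and> g j \<le> f i \<longrightarrow> g j < g i)"

text \<open>The smallest element \<open>b\<close> is placed last, and its row is forced: it is the
  first row left empty by the larger elements in which \<open>b\<close> fits. Removing
  \<open>b\<close> leaves a greedy placement of the rest, so induction applies.\<close>

lemma placed_below_unique:
  assumes "finite C" "0 \<notin> C" "placed_below f g" "placed_below f h"
    "range g - {0} = C" "range h - {0} = C"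
  shows "g = h"
  using assms
proof (induction C arbitrary: g h rule: finite_linorder_min_induct)
  case empty
  show ?case
  proof
    fix i
    have "g i \<in> {0}" "h i \<in> {0}"
      using empty(4,5) by blast+
    then show "g i = h i" by simp
  qed
next
  case (insert b C)
  have *: "\<exists>r. g r = b \<and> placed_below f (g(r := 0)) \<and> range (g(r := 0)) - {0} = C \<and>
      r = (LEAST s. b \<le> f s \<and> (g(r := 0)) s = 0)"
    if g: "placed_below f g" and C: "range g - {0} = insert b C" for g
  proof -
    have b: "0 < b" using insert.prems by auto
    have "b \<in> range g" using C by blast
    then obtain r where r: "g r = b" by blast
    have inj: "i = r" if "g i = b" for i
      using g that r b unfolding placed_below_def inj_on_def by auto
    have gt: "b < g i" if "0 < g i" "i \<noteq> r" for i
    proof -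
      have "g i \<in> range g - {0}" using that by simp
      then have "g i \<in> insert b C" using C by simp
      then show ?thesis using inj[of i] that insert.hyps by auto
    qed
    have up: "g j < g i" if "i < j" "0 < g j" "g j \<le> f i" for i j
      using g that by (auto simp: placed_below_def)
    have "placed_below f (g(r := 0))"
      unfolding placed_below_def
    proof (intro conjI allI impI)
      show "(g(r := 0)) i \<le> f i" for i
        using g by (simp add: placed_below_def)
      show "inj_on (g(r := 0)) {i. 0 < (g(r := 0)) i}"
        using g by (auto simp: placed_below_def inj_on_def)
      fix i j assume ij: "i < j \<and> 0 < (g(r := 0)) j \<and> (g(r := 0)) j \<le> f i"
      then have "j \<noteq> r" by auto
      \<comment> \<open>From \<open>b < g j < g i\<close> it follows that row \<open>i\<close> is
        not the emptied row \<open>r\<close>, so this inequality survives the removal.\<close>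
      then have "g j < g i" "b < g j" using ij up[of i j] gt[of j] by auto
      then show "(g(r := 0)) j < (g(r := 0)) i" using \<open>j \<noteq> r\<close> r by auto
    qed
    moreover have "range (g(r := 0)) - {0} = C"
    proof -
      have "range (g(r := 0)) = insert 0 (g ` (- {r}))"
        by (auto simp: fun_upd_def)
      moreover have "g ` (- {r}) = range g - {b}"
        using r inj by blast
      ultimately have "range (g(r := 0)) - {0} = range g - {0} - {b}"
        by auto
      then show ?thesis using C insert.hyps by auto
    qed
    \<comment> \<open>An earlier row in which \<open>b\<close> fits must hold an entry larger than
      \<open>b\<close> by the placement condition, so it is not empty.\<close>
    moreover have "r = (LEAST s. b \<le> f s \<and> (g(r := 0)) s = 0)"
    proof (rule Least_equality[symmetric])
      show "b \<le> f r \<and> (g(r := 0)) r = 0"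
        using g r by (auto simp: placed_below_def)
      fix s assume s: "b \<le> f s \<and> (g(r := 0)) s = 0"
      show "r \<le> s"
      proof (rule ccontr)
        assume "\<not> r \<le> s"
        then have "b < g s" "s \<noteq> r" using up[of s r] r b s by auto
        then show False using s by simp
      qed
    qed
    ultimately show ?thesis
      using r by (intro exI[of _ r] conjI)
  qed
  obtain r where r: "g r = b" "placed_below f (g(r := 0))" "range (g(r := 0)) - {0} = C"
      "r = (LEAST s. b \<le> f s \<and> (g(r := 0)) s = 0)"
    using *[OF insert.prems(2,4)] by (elim exE conjE)
  obtain s where s: "h s = b" "placed_below f (h(s := 0))" "range (h(s := 0)) - {0} = C"
      "s = (LEAST t. b \<le> f t \<and> (h(s := 0)) t = 0)"
    using *[OF insert.prems(3,5)] by (elim exE conjE)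
  have eq: "g(r := 0) = h(s := 0)"
    by (rule insert.IH[OF _ r(2) s(2) r(3) s(3)]) (use insert.prems in blast)
  have rs: "r = s"
    by (subst r(4), subst s(4)) (simp only: eq)
  show ?case
  proof
    fix i
    show "g i = h i"
      using fun_cong[OF eq, of i] r(1) s(1) rs by (cases "i = r") simp_all
  qed
qed

text \<open>A counting argument of Hall type: if the smallest element \<open>b\<close> had no empty
  row to go to, all rows with value at least \<open>b\<close> would be among the
  \<open>card C\<close> occupied ones, fewer than the count requires. The bound is restricted to
  finite sets of rows because \<open>card\<close> of an infinite set is 0 and \<open>f\<close> may
  be the basement.\<close>

lemma placed_below_exists:
  assumes "finite C" "0 \<notin> C"
    "\<And>x. x \<in> C \<Longrightarrow> finite {i. x \<le> f i} \<Longrightarrow> card {c \<in> C. x \<le> c} \<le> card {i. x \<le> f i}"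
  shows "\<exists>g. placed_below f g \<and> range g - {0} = C"
  using assms
proof (induction C rule: finite_linorder_min_induct)
  case empty
  show ?case by (rule exI[of _ "\<lambda>_. 0"]) (auto simp: placed_below_def)
next
  case (insert b C)
  have "\<exists>g. placed_below f g \<and> range g - {0} = C"
  proof (rule insert.IH)
    show "0 \<notin> C" using insert.prems by simp
    fix x assume x: "x \<in> C" "finite {i. x \<le> f i}"
    have "card {c \<in> C. x \<le> c} \<le> card {c \<in> insert b C. x \<le> c}"
      by (rule card_mono) (use insert.hyps in auto)
    also have "\<dots> \<le> card {i. x \<le> f i}"
      using insert.prems x by simp
    finally show "card {c \<in> C. x \<le> c} \<le> card {i. x \<le> f i}" .
  qed
  then obtain g where g: "placed_below f g" and C: "range g - {0} = C" by blast
  have b: "0 < b" using insert.prems by auto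
  have inj: "inj_on g {i. 0 < g i}" and le: "g i \<le> f i" for i
    using g by (auto simp: placed_below_def)
  have gC: "g ` {i. 0 < g i} = C" using C by auto
  then have fing: "finite {i. 0 < g i}" and cardg: "card {i. 0 < g i} = card C"
    using inj insert.hyps by (auto simp: finite_image_iff card_image)
  have gt: "b < g i" if "0 < g i" for i
    using that insert.hyps gC by blast
  have "\<exists>r. b \<le> f r \<and> g r = 0"
  proof (rule ccontr)
    assume "\<not> ?thesis"
    then have sub: "{i. b \<le> f i} \<subseteq> {i. 0 < g i}" by auto
    then have "finite {i. b \<le> f i}" using fing finite_subset by blast
    then have "card {c \<in> insert b C. b \<le> c} \<le> card {i. b \<le> f i}"
      using insert.prems by simp
    also have "\<dots> \<le> card C"
      using card_mono[OF fing sub] cardg by simp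
    finally have "card {c \<in> insert b C. b \<le> c} \<le> card C" .
    moreover have "{c \<in> insert b C. b \<le> c} = insert b C" "b \<notin> C"
      using insert.hyps by (auto simp: less_imp_le)
    ultimately show False
      using insert.hyps by simp
  qed
  \<comment> \<open>Taking the least such row secures the placement condition for \<open>b\<close>:
    every earlier row in which \<open>b\<close> fits is occupied, by a larger element.\<close>
  then obtain r where r: "b \<le> f r" "g r = 0" and least: "\<And>s. b \<le> f s \<and> g s = 0 \<Longrightarrow> r \<le> s"
    using exists_least_iff[of "\<lambda>r. b \<le> f r \<and> g r = 0"] by (metis not_le)
  have "placed_below f (g(r := b))"
    unfolding placed_below_def
  proof (intro conjI allI impI)
    show "(g(r := b)) i \<le> f i" for i
      using le r by simp
    show "inj_on (g(r := b)) {i. 0 < (g(r := b)) i}"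
      using inj gt unfolding inj_on_def by (auto split: if_splits)
    fix i j assume ij: "i < j \<and> 0 < (g(r := b)) j \<and> (g(r := b)) j \<le> f i"
    show "(g(r := b)) j < (g(r := b)) i"
    proof (cases "j = r")
      case True
      then have "g i \<noteq> 0" using least[of i] ij by auto
      then show ?thesis using True gt[of i] ij by auto
    next
      case False
      then have "g j < g i" using g ij by (auto simp: placed_below_def)
      then show ?thesis using False r by auto
    qed
  qed
  moreover have "range (g(r := b)) - {0} = insert b C"
  proof -
    have "range (g(r := b)) = insert b (g ` (- {r}))"
      by (auto simp: fun_upd_def)
    moreover have "range g = insert 0 (g ` (- {r}))"
      using r(2) by (metis Compl_insert image_insert insert_UNIV insert_Diff_single Compl_eq_Diff_UNIV)
    then have "g ` (- {r}) - {0} = C"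
      using C by auto
    ultimately show ?thesis using b by auto
  qed
  ultimately show ?case by blast
qed

section \<open>Anchors and free entries\<close>

text \<open>
  Anchors are recorded with value 0 outside the diagram, so weakly decreasing rows force
  left-justified rows. Column 0 is 0 as well; the basement is put back in \<open>skyline\<close> below.
\<close>

definition array :: "(nat \<Rightarrow> nat \<Rightarrow> nat) \<Rightarrow> bool" where
  "array \<alpha> \<longleftrightarrow> (\<forall>j. \<alpha> 0 j = 0) \<and> (\<forall>i. \<alpha> i 0 = 0) \<and> (\<forall>i j. 1 \<le> j \<longrightarrow> \<alpha> i (Suc j) \<le> \<alpha> i j) \<and>
     (\<forall>j. inj_on (\<lambda>i. \<alpha> i j) {i. 0 < \<alpha> i j}) \<and> (\<forall>j. finite {i. 0 < \<alpha> i j})"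

definition column_set :: "(nat \<Rightarrow> nat \<Rightarrow> nat) \<Rightarrow> nat \<Rightarrow> nat set" where
  "column_set \<alpha> j = range (\<lambda>i. \<alpha> i j) - {0}"

definition free_rows :: "(nat \<Rightarrow> nat \<Rightarrow> nat) \<Rightarrow> nat \<Rightarrow> nat \<Rightarrow> nat set" where
  "free_rows \<alpha> x j = {i. x < \<alpha> i j \<and> \<alpha> i (Suc j) \<le> x}"

text \<open>The possible free entries of column \<open>j\<close>, expressed by the anchor sets
  alone; the count comparison says that some row has room for \<open>x\<close>.\<close>

definition addable :: "(nat \<Rightarrow> nat set) \<Rightarrow> nat \<Rightarrow> nat set" where
  "addable A j = {x. 1 \<le> x \<and> x \<notin> A j \<and> card {a \<in> A (Suc j). x < a} < card {a \<in> A j. x < a}}"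

definition array_of :: "filling \<Rightarrow> nat \<Rightarrow> nat \<Rightarrow> nat" where
  "array_of F i j = (if F i j = {} then 0 else Max (F i j))"

definition free_part :: "filling \<Rightarrow> nat \<Rightarrow> nat set" where
  "free_part F j = (\<Union>i. F i j) - column_set (array_of F) j"

text \<open>
  The function \<open>sel\<close> chooses among the possible rows of a free entry: \<open>Min\<close> for skyline fillings
  and \<open>Max\<close> for reverse tableaux.
\<close>

definition canonical :: "(nat set \<Rightarrow> nat) \<Rightarrow> filling \<Rightarrow> bool" where
  "canonical sel F \<longleftrightarrow> array (array_of F) \<and> (\<forall>i j. finite (F i j) \<and> 0 \<notin> F i j) \<and>
     columns_distinct F \<and>
     (\<forall>i j. \<forall>x \<in> F i j. x \<noteq> array_of F i j \<longrightarrow>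
        i \<in> free_rows (array_of F) x j \<and> sel (free_rows (array_of F) x j) = i)"

text \<open>The inverse construction: \<open>sel\<close> decides the row of each free entry, and
  removing 0 keeps missing boxes free of a spurious anchor.\<close>

definition fill_of :: "(nat set \<Rightarrow> nat) \<Rightarrow> (nat \<Rightarrow> nat \<Rightarrow> nat) \<Rightarrow> (nat \<Rightarrow> nat set) \<Rightarrow> filling" where
  "fill_of sel \<alpha> B i j = ({\<alpha> i j} - {0}) \<union> {x \<in> B j. sel (free_rows \<alpha> x j) = i}"

section \<open>Room for free entries, and reconstruction of a filling from its column data\<close>

lemma card_column_set_greater:
  assumes "array \<alpha>"
  shows "card {a \<in> column_set \<alpha> j. x < a} = card {i. x < \<alpha> i j}"
proof -
  have "{a \<in> column_set \<alpha> j. x < a} = (\<lambda>i. \<alpha> i j) ` {i. x < \<alpha> i j}"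
    by (auto simp: column_set_def)
  moreover have "inj_on (\<lambda>i. \<alpha> i j) {i. x < \<alpha> i j}"
    by (rule inj_on_subset[of _ "{i. 0 < \<alpha> i j}"]) (use assms in \<open>auto simp: array_def\<close>)
  ultimately show ?thesis by (simp add: card_image)
qed

lemma finite_array_rows:
  assumes "array \<alpha>"
  shows "finite {i. x < \<alpha> i j}"
  by (rule finite_subset[of _ "{i. 0 < \<alpha> i j}"]) (use assms in \<open>auto simp: array_def\<close>)

lemma finite_free_rows:
  assumes "array \<alpha>"
  shows "finite (free_rows \<alpha> x j)"
  using finite_array_rows[OF assms, of x j] by (rule rev_finite_subset) (auto simp: free_rows_def)

text \<open>Since rows decrease weakly, the rows whose anchor exceeds \<open>x\<close> in column
  \<open>j + 1\<close> are among those in column \<open>j\<close>, and \<open>free_rows\<close> is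
  the difference. For finite sets, proper inclusion is the strict inequality of cardinalities.
  Column 0 is empty in an array, so both sides fail there.\<close>

lemma free_rows_nonempty_iff:
  assumes "array \<alpha>"
  shows "free_rows \<alpha> x j \<noteq> {} \<longleftrightarrow>
    card {a \<in> column_set \<alpha> (Suc j). x < a} < card {a \<in> column_set \<alpha> j. x < a}"
proof (cases "j = 0")
  case True
  then show ?thesis
    using assms by (simp add: array_def free_rows_def column_set_def)
next
  case False
  let ?S = "{i. x < \<alpha> i j}" and ?T = "{i. x < \<alpha> i (Suc j)}"
  have fin: "finite ?S"
    using assms by (rule finite_array_rows)
  have le: "\<alpha> i (Suc j) \<le> \<alpha> i j" for i
    using assms False by (simp add: array_def)
  have sub: "?T \<subseteq> ?S"
    using le by (auto intro: less_le_trans)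
  have "free_rows \<alpha> x j = ?S - ?T"
    by (auto simp: free_rows_def)
  then have "free_rows \<alpha> x j \<noteq> {} \<longleftrightarrow> ?T \<subset> ?S"
    using sub by blast
  also have "\<dots> \<longleftrightarrow> card ?T < card ?S"
    using sub psubset_card_mono[OF fin] by auto
  finally show ?thesis
    by (simp add: card_column_set_greater[OF assms])
qed

lemma array_of_in_column_set:
  assumes "x \<in> F i j" "\<And>i j. finite (F i j) \<and> 0 \<notin> F i j"
  shows "array_of F i j \<in> column_set (array_of F) j" "array_of F i j \<in> F i j" "x \<le> array_of F i j"
proof -
  have "Max (F i j) \<in> F i j"
    using assms by (intro Max_in) auto
  then show "array_of F i j \<in> F i j"
    using assms by (auto simp: array_of_def)
  then have "array_of F i j \<noteq> 0"
    using assms by metis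
  then show "array_of F i j \<in> column_set (array_of F) j"
    by (auto simp: column_set_def)
  show "x \<le> array_of F i j"
    using assms by (auto simp: array_of_def)
qed

lemma column_set_array_of_subset:
  assumes "\<And>i j. finite (F i j) \<and> 0 \<notin> F i j"
  shows "column_set (array_of F) j \<subseteq> (\<Union>i. F i j)"
proof
  fix a assume "a \<in> column_set (array_of F) j"
  then obtain i where "a = array_of F i j" "a \<noteq> 0"
    by (auto simp: column_set_def)
  moreover from this obtain x where "x \<in> F i j"
    by (auto simp: array_of_def split: if_splits)
  ultimately show "a \<in> (\<Union>i. F i j)"
    using array_of_in_column_set(2)[of x F i j] assms by blast
qed

text \<open>Nothing is lost by forgetting the rows of the free entries, because \<open>sel\<close>
  dictates them. This yields injectivity of the passage to column data.\<close>

lemma fill_of_array_of: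
  assumes "canonical sel F"
  shows "fill_of sel (array_of F) (free_part F) = F"
proof (intro ext)
  fix i j
  have fin: "\<And>i j. finite (F i j) \<and> 0 \<notin> F i j" and dist: "columns_distinct F"
    and sel: "\<And>i j x. x \<in> F i j \<Longrightarrow> x \<noteq> array_of F i j \<Longrightarrow>
      i \<in> free_rows (array_of F) x j \<and> sel (free_rows (array_of F) x j) = i"
    and zero: "array_of F i 0 = 0" for i
    using assms by (auto simp: canonical_def array_def)
  note max = array_of_in_column_set[of _ F, OF _ fin]
  have j: "1 \<le> j" if "x \<in> F i j" for x i j
    using max(2)[OF that] zero fin by (metis less_one not_le)
  show "fill_of sel (array_of F) (free_part F) i j = F i j" (is "?L = _")
  proof (intro equalityI subsetI)
    fix x assume "x \<in> ?L"
    then consider "x = array_of F i j" "x \<noteq> 0" | "x \<in> free_part F j" "sel (free_rows (array_of F) x j) = i"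
      by (auto simp: fill_of_def)
    then show "x \<in> F i j"
    proof cases
      case 1
      then show ?thesis
        using max(2) by (metis array_of_def ex_in_conv)
    next
      case 2
      then obtain i' where i': "x \<in> F i' j" and "x \<notin> column_set (array_of F) j"
        by (auto simp: free_part_def)
      then have "x \<noteq> array_of F i' j"
        using max(1) by metis
      then show ?thesis
        using sel[OF i'] 2 i' by auto
    qed
  next
    fix x assume x: "x \<in> F i j"
    show "x \<in> ?L"
    proof (cases "x = array_of F i j")
      case True
      then show ?thesis
        using x fin[of i j] by (auto simp: fill_of_def)
    next
      case False
      \<comment> \<open>If \<open>x\<close> were also an anchor of this column, distinctness of
        column entries would make it the anchor of this very box.\<close>
      have "x \<notin> column_set (array_of F) j"
      proof
        assume "x \<in> column_set (array_of F) j"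
        then obtain i' where i': "x = array_of F i' j" "x \<noteq> 0"
          by (auto simp: column_set_def)
        then have "x \<in> F i' j"
          using max(2) by (metis array_of_def ex_in_conv)
        then have "i' = i"
          using dist x j[OF x] unfolding columns_distinct_def by blast
        then show False using i' False by simp
      qed
      then have "x \<in> free_part F j"
        using x by (auto simp: free_part_def)
      then show ?thesis
        using sel[OF x False] by (simp add: fill_of_def)
    qed
  qed
qed

lemma free_part_subset_addable:
  assumes "canonical sel F"
  shows "free_part F j \<subseteq> addable (column_set (array_of F)) j"
proof
  fix x assume x: "x \<in> free_part F j"
  have fin: "\<And>i j. finite (F i j) \<and> 0 \<notin> F i j" and arr: "array (array_of F)"
    using assms by (auto simp: canonical_def)
  obtain i where i: "x \<in> F i j" and x_col: "x \<notin> column_set (array_of F) j"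
    using x by (auto simp: free_part_def)
  then have "x \<noteq> array_of F i j"
    using array_of_in_column_set(1)[of x F i j, OF i fin] by metis
  then have "free_rows (array_of F) x j \<noteq> {}"
    using assms i unfolding canonical_def by blast
  moreover have "1 \<le> x"
    using fin[of i j] i by (cases x) auto
  ultimately show "x \<in> addable (column_set (array_of F)) j"
    using x_col free_rows_nonempty_iff[OF arr] by (simp add: addable_def)
qed

text \<open>Addability guarantees a possible row for each free entry, and the anchor of that row is
  larger. So inserting free entries changes no maximum, and both the anchors and the free entries
  can be read off again.\<close>

lemma
  assumes sel: "\<And>S. finite S \<Longrightarrow> S \<noteq> {} \<Longrightarrow> sel S \<in> S"
    and arr: "array \<alpha>" and B: "\<And>j. B j \<subseteq> addable (column_set \<alpha>) j"
  shows array_of_fill_of: "array_of (fill_of sel \<alpha> B) = \<alpha>"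
    and free_part_fill_of: "free_part (fill_of sel \<alpha> B) = B"
    and canonical_fill_of: "canonical sel (fill_of sel \<alpha> B)"
proof -
  let ?F = "fill_of sel \<alpha> B"
  have row: "sel (free_rows \<alpha> x j) \<in> free_rows \<alpha> x j" if "x \<in> B j" for x j
  proof (rule sel)
    show "finite (free_rows \<alpha> x j)"
      using arr by (rule finite_free_rows)
    show "free_rows \<alpha> x j \<noteq> {}"
      using that B[of j] free_rows_nonempty_iff[OF arr, of x j] by (auto simp: addable_def)
  qed
  then have less: "x < \<alpha> i j" if "x \<in> B j" "sel (free_rows \<alpha> x j) = i" for x i j
    using that by (force simp: free_rows_def)
  have not_col: "x \<notin> column_set \<alpha> j" and pos: "x \<noteq> 0" if "x \<in> B j" for x j
    using that B[of j] by (auto simp: addable_def)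
  have le: "x \<le> \<alpha> i j" if "x \<in> ?F i j" for x i j
    using that less by (auto simp: fill_of_def less_imp_le)
  \<comment> \<open>Finiteness of a box comes from the bound of all its entries by its
    anchor.\<close>
  have fin: "finite (?F i j)" for i j
    by (rule finite_subset[of _ "{..\<alpha> i j}"]) (use le in auto)
  have max: "array_of ?F i j = \<alpha> i j" for i j
  proof (cases "\<alpha> i j = 0")
    case True
    then have "?F i j = {}"
      using less by (fastforce simp: fill_of_def)
    then show ?thesis
      using True by (simp add: array_of_def)
  next
    case False
    then have "\<alpha> i j \<in> ?F i j"
      by (simp add: fill_of_def)
    moreover from this have "Max (?F i j) = \<alpha> i j"
      using fin le by (intro Max_eqI) auto
    ultimately show ?thesis
      by (auto simp: array_of_def)
  qed
  then show array_of: "array_of ?F = \<alpha>"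
    by blast
  have zero: "0 \<notin> ?F i j" for i j
    using pos by (auto simp: fill_of_def)
  have inj: "i = i'" if "\<alpha> i j = \<alpha> i' j" "\<alpha> i j \<noteq> 0" for i i' j
  proof -
    have "inj_on (\<lambda>i. \<alpha> i j) {i. 0 < \<alpha> i j}"
      using arr by (simp add: array_def)
    then show ?thesis
      using that by (auto dest: inj_onD)
  qed
  have col: "\<alpha> i j \<in> column_set \<alpha> j" if "\<alpha> i j \<noteq> 0" for i j
    using that by (auto simp: column_set_def)
  show "free_part ?F = B"
  proof
    fix j
    show "free_part ?F j = B j"
      using not_col col by (auto simp: free_part_def array_of fill_of_def)
  qed
  have "columns_distinct ?F"
    unfolding columns_distinct_def
  proof (intro allI impI, rule ccontr)
    fix i i' j assume i: "1 \<le> j \<and> i \<noteq> i'" and "?F i j \<inter> ?F i' j \<noteq> {}"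
    then obtain x where x: "x \<in> ?F i j" "x \<in> ?F i' j" by blast
    show False
    proof (cases "x \<in> B j")
      case True
      then show ?thesis
        using x i not_col[OF True] col by (auto simp: fill_of_def)
    next
      case False
      then show ?thesis
        using x i inj[of i j i'] by (auto simp: fill_of_def)
    qed
  qed
  then show "canonical sel ?F"
    unfolding canonical_def array_of using arr fin zero row
    by (auto simp: fill_of_def)
qed

text \<open>Reduces the bijection to anchors. The choices of free entries over a given
  \<open>A\<close> depend on \<open>A\<close> only, neither on \<open>sel\<close> nor on
  \<open>Q\<close>, so two families with the same \<open>D\<close> get the same target.\<close>

lemma bij_betw_canonical:
  assumes sel: "\<And>S. finite S \<Longrightarrow> S \<noteq> {} \<Longrightarrow> sel S \<in> S"
    and bij: "bij_betw column_set {\<alpha>. array \<alpha> \<and> Q \<alpha>} D"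
  shows "bij_betw (\<lambda>F. (column_set (array_of F), free_part F))
    {F. canonical sel F \<and> Q (array_of F)} (SIGMA A:D. {B. \<forall>j. B j \<subseteq> addable A j})"
proof (rule bij_betw_imageI)
  show "inj_on (\<lambda>F. (column_set (array_of F), free_part F)) {F. canonical sel F \<and> Q (array_of F)}"
  proof (rule inj_onI)
    fix F G assume F: "F \<in> {F. canonical sel F \<and> Q (array_of F)}"
      and G: "G \<in> {F. canonical sel F \<and> Q (array_of F)}"
      and eq: "(column_set (array_of F), free_part F) = (column_set (array_of G), free_part G)"
    have "array_of F = array_of G"
      using bij F G eq by (auto simp: bij_betw_def canonical_def dest: inj_onD)
    then have "fill_of sel (array_of F) (free_part F) = fill_of sel (array_of G) (free_part G)"
      using eq by simp
    moreover have "canonical sel F" "canonical sel G"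
      using F G by auto
    ultimately show "F = G"
      by (simp only: fill_of_array_of)
  qed
  show "(\<lambda>F. (column_set (array_of F), free_part F)) ` {F. canonical sel F \<and> Q (array_of F)} =
      (SIGMA A:D. {B. \<forall>j. B j \<subseteq> addable A j})"
  proof (intro equalityI subsetI)
    fix d assume "d \<in> (\<lambda>F. (column_set (array_of F), free_part F)) ` {F. canonical sel F \<and> Q (array_of F)}"
    then show "d \<in> (SIGMA A:D. {B. \<forall>j. B j \<subseteq> addable A j})"
      using free_part_subset_addable bij_betwE[OF bij] by (auto simp: canonical_def)
  next
    fix d assume "d \<in> (SIGMA A:D. {B. \<forall>j. B j \<subseteq> addable A j})"
    then obtain A B where d: "d = (A, B)" and A: "A \<in> D" and B: "\<And>j. B j \<subseteq> addable A j"
      by blast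
    obtain \<alpha> where \<alpha>: "array \<alpha>" "Q \<alpha>" "A = column_set \<alpha>"
      using bij A by (auto simp: bij_betw_def)
    note fill = array_of_fill_of free_part_fill_of canonical_fill_of
    show "d \<in> (\<lambda>F. (column_set (array_of F), free_part F)) ` {F. canonical sel F \<and> Q (array_of F)}"
      using fill[of sel \<alpha> B, OF sel \<alpha>(1)] B \<alpha>(2,3) d
      by (intro image_eqI[of _ _ "fill_of sel \<alpha> B"]) auto
  qed
qed

section \<open>Arrays of anchors with given column sets\<close>

text \<open>The sequences of anchor sets that occur. The count inequality is what allows weakly
  decreasing rows; the last condition prescribes the column lengths of the diagram of
  \<open>\<mu>\<close>, which do not change when its rows are permuted.\<close>

definition column_data :: "(nat \<Rightarrow>\<^sub>0 nat) \<Rightarrow> (nat \<Rightarrow> nat set) set" where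
  "column_data \<mu> = {A. A 0 = {} \<and> (\<forall>j. finite (A j) \<and> 0 \<notin> A j) \<and>
     (\<forall>j\<ge>1. \<forall>x. card {a \<in> A (Suc j). x < a} \<le> card {a \<in> A j. x < a}) \<and>
     (\<forall>j\<ge>1. card (A j) = card {i. j \<le> lookup \<mu> i})}"

definition has_columns :: "(nat \<Rightarrow>\<^sub>0 nat) \<Rightarrow> (nat \<Rightarrow> nat \<Rightarrow> nat) \<Rightarrow> bool" where
  "has_columns \<mu> \<alpha> \<longleftrightarrow> (\<forall>j\<ge>1. card (column_set \<alpha> j) = card {i. j \<le> lookup \<mu> i})"

definition column_strict :: "(nat \<Rightarrow> nat \<Rightarrow> nat) \<Rightarrow> bool" where
  "column_strict \<alpha> \<longleftrightarrow> (\<forall>j. column_ordered (\<lambda>i. \<alpha> i j))"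

definition skyline :: "(nat \<Rightarrow> nat \<Rightarrow> nat) \<Rightarrow> bool" where
  "skyline \<alpha> \<longleftrightarrow> (\<forall>j. placed_below (\<lambda>i. if j = 0 then i else \<alpha> i j) (\<lambda>i. \<alpha> i (Suc j)))"

lemma column_set_in_column_data:
  assumes "array \<alpha>" "has_columns \<mu> \<alpha>"
  shows "column_set \<alpha> \<in> column_data \<mu>"
proof -
  have "finite (column_set \<alpha> j)" for j
  proof -
    have "column_set \<alpha> j = (\<lambda>i. \<alpha> i j) ` {i. 0 < \<alpha> i j}"
      by (auto simp: column_set_def)
    then show ?thesis
      using finite_array_rows[OF assms(1), of 0 j] by simp
  qed
  moreover have "card {a \<in> column_set \<alpha> (Suc j). x < a} \<le> card {a \<in> column_set \<alpha> j. x < a}"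
    if "1 \<le> j" for j x
  proof -
    have "{i. x < \<alpha> i (Suc j)} \<subseteq> {i. x < \<alpha> i j}"
      using assms(1) that by (auto simp: array_def intro: less_le_trans)
    then show ?thesis
      using card_mono[OF finite_array_rows[OF assms(1)]] by (simp add: card_column_set_greater[OF assms(1)])
  qed
  moreover have "column_set \<alpha> 0 = {}" "0 \<notin> column_set \<alpha> j" for j
    using assms(1) by (auto simp: column_set_def array_def)
  ultimately show ?thesis
    using assms(2) by (simp add: column_data_def has_columns_def)
qed

lemma column_data_mono:
  assumes "A \<in> column_data \<mu>" "1 \<le> j" "1 \<le> x"
  shows "card {a \<in> A (Suc j). x \<le> a} \<le> card {a \<in> A j. x \<le> a}"
proof -
  have *: "x \<le> a \<longleftrightarrow> x - 1 < a" for a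
    using assms(3) by auto
  show ?thesis
    unfolding * using assms(1,2) by (auto simp: column_data_def)
qed

text \<open>Each column is the sorted list of its set, hence determined by it. Conversely, sorting
  the columns of admissible data gives weakly decreasing rows by comparing thresholds.\<close>

lemma bij_betw_column_strict:
  "bij_betw column_set {\<alpha>. array \<alpha> \<and> column_strict \<alpha> \<and> has_columns \<mu> \<alpha>} (column_data \<mu>)"
proof (rule bij_betw_imageI)
  show "inj_on column_set {\<alpha>. array \<alpha> \<and> column_strict \<alpha> \<and> has_columns \<mu> \<alpha>}"
  proof (rule inj_onI, intro ext)
    fix \<alpha> \<alpha>' i j
    assume \<alpha>: "\<alpha> \<in> {\<alpha>. array \<alpha> \<and> column_strict \<alpha> \<and> has_columns \<mu> \<alpha>}"
      and \<alpha>': "\<alpha>' \<in> {\<alpha>. array \<alpha> \<and> column_strict \<alpha> \<and> has_columns \<mu> \<alpha>}"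
      and eq: "column_set \<alpha> = column_set \<alpha>'"
    have thr: "x \<le> \<alpha> i j \<longleftrightarrow> 1 \<le> i \<and> i \<le> card {a \<in> column_set \<alpha> j. x \<le> a}"
      if "1 \<le> x" "array \<alpha>" "column_strict \<alpha>" for x and \<alpha> :: "nat \<Rightarrow> nat \<Rightarrow> nat"
      unfolding column_set_def
      by (rule column_ordered_threshold) (use that in \<open>auto simp: array_def column_strict_def\<close>)
    have "x \<le> \<alpha> i j \<longleftrightarrow> x \<le> \<alpha>' i j" if "1 \<le> x" for x
      using thr[of x \<alpha>] thr[of x \<alpha>'] \<alpha> \<alpha>' eq that by simp
    \<comment> \<open>Each entry in turn serves as threshold for the other. Zero entries are treated
      apart, as thresholds start at 1.\<close>
    from this[of "\<alpha> i j"] this[of "\<alpha>' i j"] show "\<alpha> i j = \<alpha>' i j"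
      by (cases "\<alpha> i j = 0"; cases "\<alpha>' i j = 0") auto
  qed
  show "column_set ` {\<alpha>. array \<alpha> \<and> column_strict \<alpha> \<and> has_columns \<mu> \<alpha>} = column_data \<mu>"
  proof (intro equalityI subsetI)
    fix A assume A: "A \<in> column_data \<mu>"
    have "\<forall>j. \<exists>f. column_ordered f \<and> finite {i. 0 < f i} \<and> range f - {0} = A j"
      using A column_ordered_exists by (auto simp: column_data_def)
    then obtain f where f: "column_ordered (f j)" "finite {i. 0 < f j i}" "range (f j) - {0} = A j" for j
      by metis
    define \<alpha> where "\<alpha> i j = f j i" for i j
    have thr: "x \<le> \<alpha> i j \<longleftrightarrow> 1 \<le> i \<and> i \<le> card {a \<in> A j. x \<le> a}" if "1 \<le> x" for x i j
      using column_ordered_threshold[OF f(1,2) that] by (simp add: \<alpha>_def f(3))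
    have "\<alpha> i 0 = 0" for i
    proof (rule ccontr)
      assume "\<alpha> i 0 \<noteq> 0"
      then have "\<alpha> i 0 \<in> range (f 0) - {0}"
        by (auto simp: \<alpha>_def)
      then show False
        using f(3)[of 0] A by (simp add: column_data_def)
    qed
    moreover have "\<alpha> i (Suc j) \<le> \<alpha> i j" if "1 \<le> j" for i j
    proof (cases "\<alpha> i (Suc j) = 0")
      case False
      \<comment> \<open>With the entry itself as threshold, row \<open>i\<close> lies in the initial
        segment of column \<open>j + 1\<close>, hence in the one of column \<open>j\<close>, which
        is at least as long.\<close>
      then have x: "1 \<le> \<alpha> i (Suc j)" by simp
      show ?thesis
        using thr[OF x, of i j] thr[OF x, of i "Suc j"] column_data_mono[OF A that x] by auto
    qed simp
    moreover have "inj_on (\<lambda>i. \<alpha> i j) {i. 0 < \<alpha> i j}" for j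
      using column_ordered_inj[OF f(1)] by (simp add: \<alpha>_def)
    ultimately have "array \<alpha>"
      using f by (auto simp: array_def \<alpha>_def column_ordered_def)
    moreover have "column_strict \<alpha>"
      using f by (simp add: column_strict_def \<alpha>_def)
    moreover have "column_set \<alpha> = A"
      using f by (auto simp: column_set_def \<alpha>_def)
    moreover from this have "has_columns \<mu> \<alpha>"
      using A by (simp add: has_columns_def column_data_def)
    ultimately show "A \<in> column_set ` {\<alpha>. array \<alpha> \<and> column_strict \<alpha> \<and> has_columns \<mu> \<alpha>}"
      by blast
  qed (use column_set_in_column_data in blast)
qed

lemma skyline_eqI:
  assumes "array \<alpha>" "array \<alpha>'" "skyline \<alpha>" "skyline \<alpha>'" "column_set \<alpha> = column_set \<alpha>'"
    "\<And>j. finite (column_set \<alpha> j)"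
  shows "\<alpha> = \<alpha>'"
proof -
  have "(\<lambda>i. \<alpha> i j) = (\<lambda>i. \<alpha>' i j)" for j
  proof (induction j)
    case 0
    then show ?case using assms(1,2) by (simp add: array_def)
  next
    case (Suc j)
    show ?case
    proof (rule placed_below_unique)
      show "finite (column_set \<alpha> (Suc j))" "0 \<notin> column_set \<alpha> (Suc j)"
        using assms(6) by (auto simp: column_set_def)
      show "placed_below (\<lambda>i. if j = 0 then i else \<alpha> i j) (\<lambda>i. \<alpha> i (Suc j))"
        using assms(3) by (simp add: skyline_def)
      have "(\<lambda>i. if j = 0 then i else \<alpha> i j) = (\<lambda>i. if j = 0 then i else \<alpha>' i j)"
        by (intro ext) (simp add: fun_cong[OF Suc])
      then show "placed_below (\<lambda>i. if j = 0 then i else \<alpha> i j) (\<lambda>i. \<alpha>' i (Suc j))"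
        using assms(4) by (simp add: skyline_def)
    qed (simp_all only: assms(5) column_set_def[symmetric])
  qed
  then have "\<alpha> i j = \<alpha>' i j" for i j
    by (rule fun_cong)
  then show ?thesis by blast
qed

text \<open>Columns are built from left to right, starting with the basement. Each greedy placement
  exists by the count inequality of the data and is forced by the previous column.\<close>

lemma bij_betw_skyline:
  "bij_betw column_set {\<alpha>. array \<alpha> \<and> skyline \<alpha> \<and> has_columns \<mu> \<alpha>} (column_data \<mu>)"
proof (rule bij_betw_imageI)
  show "inj_on column_set {\<alpha>. array \<alpha> \<and> skyline \<alpha> \<and> has_columns \<mu> \<alpha>}"
  proof (rule inj_onI)
    fix \<alpha> \<alpha>'
    assume "\<alpha> \<in> {\<alpha>. array \<alpha> \<and> skyline \<alpha> \<and> has_columns \<mu> \<alpha>}"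
      and "\<alpha>' \<in> {\<alpha>. array \<alpha> \<and> skyline \<alpha> \<and> has_columns \<mu> \<alpha>}"
      and "column_set \<alpha> = column_set \<alpha>'"
    then show "\<alpha> = \<alpha>'"
      using column_set_in_column_data[of \<alpha> \<mu>] by (intro skyline_eqI) (auto simp: column_data_def)
  qed
  show "column_set ` {\<alpha>. array \<alpha> \<and> skyline \<alpha> \<and> has_columns \<mu> \<alpha>} = column_data \<mu>"
  proof (intro equalityI subsetI)
    fix A assume A: "A \<in> column_data \<mu>"
    \<comment> \<open>The invariant of the construction. Column 0 is the basement; in later columns
      injectivity is carried along so that counts of rows become counts in
      \<open>A j\<close>.\<close>
    define P where "P j f \<longleftrightarrow> (if j = 0 then f = id else inj_on f {i. 0 < f i} \<and> range f - {0} = A j)"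
      for j and f :: "nat \<Rightarrow> nat"
    have "\<exists>f. \<forall>j. P j (f j) \<and> placed_below (f j) (f (Suc j))"
    proof (rule dependent_nat_choice)
      show "\<exists>f. P 0 f" by (simp add: P_def)
      fix f j assume f: "P j f"
      have "\<exists>g. placed_below f g \<and> range g - {0} = A (Suc j)"
      proof (rule placed_below_exists)
        show "finite (A (Suc j))" "0 \<notin> A (Suc j)"
          using A by (auto simp: column_data_def)
        fix x assume x: "x \<in> A (Suc j)" and fin: "finite {i. x \<le> f i}"
        have "x \<noteq> 0"
          using x A unfolding column_data_def by (metis (mono_tags, lifting) mem_Collect_eq)
        show "card {c \<in> A (Suc j). x \<le> c} \<le> card {i. x \<le> f i}"
        proof (cases "j = 0")
          case True
          \<comment> \<open>Infinitely many basement entries are at least \<open>x\<close>, so the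
            finite case assumed in \<open>fin\<close> does not arise in column 0.\<close>
          then have "{i. x \<le> f i} = {x..}"
            using f by (auto simp: P_def)
          then show ?thesis
            using fin infinite_Ici by metis
        next
          case False
          then have "inj_on f {i. 0 < f i}" and Aj: "range f - {0} = A j"
            using f by (simp_all add: P_def)
          then have "inj_on f {i. x \<le> f i}"
            using \<open>x \<noteq> 0\<close> by (auto simp: inj_on_def)
          moreover have "{a \<in> A j. x \<le> a} = f ` {i. x \<le> f i}"
            using \<open>x \<noteq> 0\<close> by (auto simp: Aj[symmetric])
          ultimately have "card {i. x \<le> f i} = card {a \<in> A j. x \<le> a}"
            by (simp add: card_image)
          then show ?thesis
            using column_data_mono[OF A, of j x] False \<open>x \<noteq> 0\<close> by simp
        qed
      qed
      then show "\<exists>g. P (Suc j) g \<and> placed_below f g"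
        by (auto simp: P_def placed_below_def)
    qed
    then obtain f where f: "\<And>j. P j (f j)" and placed: "\<And>j. placed_below (f j) (f (Suc j))"
      by blast
    have f0: "f 0 = id" and inj: "inj_on (f (Suc j)) {i. 0 < f (Suc j) i}"
      and Aj: "range (f (Suc j)) - {0} = A (Suc j)" for j
      using f[of 0] f[of "Suc j"] by (simp_all add: P_def)
    have le: "f (Suc j) i \<le> f j i" for i j
      using placed by (simp add: placed_below_def)
    define \<alpha> where "\<alpha> i j = (if j = 0 then 0 else f j i)" for i j
    \<comment> \<open>The basement entry 0 of row 0 keeps that row zero in all columns.\<close>
    have z: "f j 0 = 0" for j
    proof (induction j)
      case (Suc j)
      then show ?case using le[of j 0] by simp
    qed (simp add: f0)
    have "column_set \<alpha> j = A j" for j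
      using Aj[of "j - 1"] A by (cases j) (auto simp: column_set_def \<alpha>_def column_data_def)
    then have cols: "column_set \<alpha> = A" ..
    have fin: "finite {i. 0 < f (Suc j) i}" for j
    proof -
      have "finite (f (Suc j) ` {i. 0 < f (Suc j) i})"
      proof (rule finite_subset)
        show "f (Suc j) ` {i. 0 < f (Suc j) i} \<subseteq> A (Suc j)"
          using Aj[of j] by auto
      qed (use A in \<open>simp add: column_data_def\<close>)
      then show ?thesis
        using inj by (simp add: finite_image_iff)
    qed
    have "array \<alpha>"
      unfolding array_def
    proof (intro conjI allI impI)
      show "\<alpha> i (Suc j) \<le> \<alpha> i j" if "1 \<le> j" for i j
        using that le[of j i] by (simp add: \<alpha>_def)
      show "inj_on (\<lambda>i. \<alpha> i j) {i. 0 < \<alpha> i j}" for j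
        using inj[of "j - 1"] by (cases j) (simp_all add: \<alpha>_def)
      show "finite {i. 0 < \<alpha> i j}" for j
        using fin[of "j - 1"] by (cases j) (simp_all add: \<alpha>_def)
    qed (simp_all add: \<alpha>_def z)
    moreover have "skyline \<alpha>"
      unfolding skyline_def
    proof
      fix j
      have "(\<lambda>i. if j = 0 then i else \<alpha> i j) = f j" "(\<lambda>i. \<alpha> i (Suc j)) = f (Suc j)"
        by (auto simp: \<alpha>_def f0)
      then show "placed_below (\<lambda>i. if j = 0 then i else \<alpha> i j) (\<lambda>i. \<alpha> i (Suc j))"
        using placed by metis
    qed
    moreover have "has_columns \<mu> \<alpha>"
      using A by (simp add: has_columns_def column_data_def cols)
    ultimately show "A \<in> column_set ` {\<alpha>. array \<alpha> \<and> skyline \<alpha> \<and> has_columns \<mu> \<alpha>}"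
      using cols by blast
  qed (use column_set_in_column_data in blast)
qed

section \<open>Skyline fillings and reverse tableaux as canonical fillings\<close>

text \<open>The positive values of \<open>array_of\<close> mark exactly the boxes of the diagram. In
  contrast, \<open>anchor\<close> is the maximum of an empty set outside the extended diagram,
  whence the second alternative in \<open>anchor_eq\<close>.\<close>

lemma
  assumes "set_valued_filling \<gamma> F"
  shows filling_entries: "finite (F i j) \<and> 0 \<notin> F i j"
    and filling_nonempty_iff: "F i j \<noteq> {} \<longleftrightarrow> (i, j) \<in> boxes \<gamma>"
    and array_of_pos_iff: "0 < array_of F i j \<longleftrightarrow> (i, j) \<in> boxes \<gamma>"
    and Max_filling: "(i, j) \<in> boxes \<gamma> \<Longrightarrow> Max (F i j) = array_of F i j"
    and anchor_eq: "anchor F i j = (if j = 0 then i else array_of F i j)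
      \<or> (i, j) \<notin> boxes_with_basement \<gamma>"
proof -
  show fin: "finite (F i j) \<and> 0 \<notin> F i j"
    using assms unfolding set_valued_filling_def by (cases "(i, j) \<in> boxes \<gamma>") auto
  show ne: "F i j \<noteq> {} \<longleftrightarrow> (i, j) \<in> boxes \<gamma>"
    using assms unfolding set_valued_filling_def by blast
  show "0 < array_of F i j \<longleftrightarrow> (i, j) \<in> boxes \<gamma>"
  proof (cases "F i j = {}")
    case False
    then have "Max (F i j) \<noteq> 0"
      using Max_in[of "F i j"] fin by metis
    then show ?thesis
      using False ne by (simp add: array_of_def)
  qed (use ne in \<open>simp add: array_of_def\<close>)
  show "Max (F i j) = array_of F i j" if "(i, j) \<in> boxes \<gamma>"
    using that ne by (simp add: array_of_def)
  show "anchor F i j = (if j = 0 then i else array_of F i j) \<or> (i, j) \<notin> boxes_with_basement \<gamma>"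
    using ne by (auto simp: anchor_def with_basement_def array_of_def boxes_def boxes_with_basement_def)
qed

lemma array_of_mem:
  assumes "set_valued_filling \<gamma> F" "(i, j) \<in> boxes \<gamma>"
  shows "array_of F i j \<in> F i j"
  using assms Max_in[of "F i j"] filling_entries[OF assms(1), of i j] filling_nonempty_iff[OF assms(1), of i j]
  by (auto simp: array_of_def)

lemma entry_le_array_of:
  assumes "set_valued_filling \<gamma> F" "x \<in> F i j"
  shows "x \<le> array_of F i j" "(i, j) \<in> boxes \<gamma>" "0 < x"
  using assms filling_entries[OF assms(1), of i j] filling_nonempty_iff[OF assms(1), of i j]
  by (auto simp: array_of_def intro!: Nat.gr0I)

text \<open>A missing box on the right has array value 0, which turns the conditional bound of
  \<open>free_position\<close> into the plain one of \<open>free_rows\<close>.\<close>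

lemma free_position_iff:
  assumes F: "set_valued_filling \<gamma> F" and "1 \<le> j"
  shows "free_position \<gamma> F x j i \<longleftrightarrow> i \<in> free_rows (array_of F) x j"
proof -
  have anc: "anchor F i j = array_of F i j" if "(i, j) \<in> boxes \<gamma>" "1 \<le> j" for j
    using that Max_filling[OF F] by (simp add: anchor_def with_basement_def)
  have "(i, j) \<in> boxes \<gamma>" if "x < array_of F i j"
    using that array_of_pos_iff[OF F, of i j] by simp
  moreover have "array_of F i (Suc j) = 0" if "(i, Suc j) \<notin> boxes \<gamma>"
    using that array_of_pos_iff[OF F, of i "Suc j"] by simp
  ultimately show ?thesis
    using anc[of j] anc[of "Suc j"] assms(2)
    by (cases "(i, Suc j) \<in> boxes \<gamma>"; cases "(i, j) \<in> boxes \<gamma>")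
      (auto simp: free_position_def free_rows_def)
qed

lemma array_array_of:
  assumes F: "set_valued_filling \<gamma> F" and dist: "columns_distinct F"
    and rows: "\<And>i j. 1 \<le> j \<Longrightarrow> (i, Suc j) \<in> boxes \<gamma> \<Longrightarrow> Min (F i j) \<ge> Max (F i (Suc j))"
  shows "array (array_of F)"
  unfolding array_def
proof (intro conjI allI impI)
  fix i j :: nat
  show "array_of F 0 j = 0" "array_of F i 0 = 0"
    using array_of_pos_iff[OF F, of 0 j] array_of_pos_iff[OF F, of i 0] by (auto simp: boxes_def)
  show "finite {i. 0 < array_of F i j}"
    by (rule finite_subset[OF _ finite_imageI[OF finite_boxes[of \<gamma>], of fst]])
      (force simp: array_of_pos_iff[OF F] image_iff)
  show "inj_on (\<lambda>i. array_of F i j) {i. 0 < array_of F i j}"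
  proof (rule inj_onI, rule ccontr)
    fix i i' assume i: "i \<in> {i. 0 < array_of F i j}" "i' \<in> {i. 0 < array_of F i j}"
      and eq: "array_of F i j = array_of F i' j" and "i \<noteq> i'"
    then have b: "(i, j) \<in> boxes \<gamma>" "(i', j) \<in> boxes \<gamma>"
      using array_of_pos_iff[OF F] by auto
    then have "array_of F i j \<in> F i j \<inter> F i' j"
      using array_of_mem[OF F, of i j] array_of_mem[OF F, of i' j] eq by simp
    moreover have "1 \<le> j"
      using b by (simp add: boxes_def)
    ultimately show False
      using dist \<open>i \<noteq> i'\<close> unfolding columns_distinct_def by blast
  qed
  show "array_of F i (Suc j) \<le> array_of F i j" if "1 \<le> j"
  proof (cases "(i, Suc j) \<in> boxes \<gamma>")
    case True
    then have b: "(i, j) \<in> boxes \<gamma>"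
      using that by (auto simp: boxes_def)
    have "array_of F i (Suc j) \<le> Min (F i j)"
      using rows[OF that True] Max_filling[OF F True] by simp
    also have "\<dots> \<le> array_of F i j"
      using array_of_mem[OF F b] filling_entries[OF F, of i j] by simp
    finally show ?thesis .
  next
    case False
    then show ?thesis
      using array_of_pos_iff[OF F, of i "Suc j"] by simp
  qed
qed

lemma canonical_rows_decreasing:
  assumes F: "set_valued_filling \<gamma> F" and can: "canonical sel F"
    and j: "1 \<le> j" "(i, Suc j) \<in> boxes \<gamma>"
  shows "Min (F i j) \<ge> Max (F i (Suc j))"
proof -
  have "(i, j) \<in> boxes \<gamma>"
    using j by (auto simp: boxes_def)
  then have "Min (F i j) \<in> F i j"
    using filling_entries[OF F, of i j] filling_nonempty_iff[OF F, of i j] by simp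
  then have "array_of F i (Suc j) \<le> Min (F i j)"
    using can j by (cases "Min (F i j) = array_of F i j")
      (auto simp: canonical_def array_def free_rows_def)
  then show ?thesis
    using Max_filling[OF F j(2)] by simp
qed

text \<open>Each type B triple leaves two alternatives, and the one with \<open>b > c\<close> must
  be excluded. In the basement it would say \<open>i > j\<close>. Further right, the inequality of
  the previous column together with the decrease of row \<open>i\<close> gives
  \<open>b < c\<close>.\<close>

lemma skyline_type_B_less:
  assumes F: "set_valued_filling \<gamma> F" and B: "type_B_triples_inverted \<gamma> F"
    and mono: "\<And>k. array_of F i (Suc k) \<le> (if k = 0 then i else array_of F i k)"
    and ij: "1 \<le> i" "i < j" "lookup \<gamma> i < lookup \<gamma> j" and k: "k \<le> lookup \<gamma> i"
  shows "(if k = 0 then i else array_of F i k) < array_of F j (Suc k)"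
  using k
proof (induction k)
  have inv: "inversion_triple (array_of F j (Suc k)) (if k = 0 then i else array_of F i k)
      (if k = 0 then j else array_of F j k)" if "k \<le> lookup \<gamma> i" for k
  proof -
    have b: "(i, k) \<in> boxes_with_basement \<gamma>" "(j, k) \<in> boxes_with_basement \<gamma>"
        "(j, Suc k) \<in> boxes_with_basement \<gamma>"
      using ij that by (simp_all add: boxes_with_basement_def)
    then have "inversion_triple (anchor F j (Suc k)) (anchor F i k) (anchor F j k)"
      using B ij unfolding type_B_triples_inverted_def Let_def by blast
    then show ?thesis
      using b anchor_eq[OF F, of i k] anchor_eq[OF F, of j k] anchor_eq[OF F, of j "Suc k"] by simp
  qed
  {
    case 0
    then show ?case
      using inv[of 0] ij by (simp add: inversion_triple_def)
  next
    case (Suc k)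
    then show ?case
      using inv[of "Suc k"] mono[of k] by (auto simp: inversion_triple_def split: if_splits)
  }
qed

lemma skyline_type_A_less:
  assumes F: "set_valued_filling \<gamma> F" and A: "type_A_triples_inverted \<gamma> F"
    and ij: "1 \<le> i" "i < j" "lookup \<gamma> j \<le> lookup \<gamma> i" and k: "(j, Suc k) \<in> boxes \<gamma>"
    and le: "array_of F j (Suc k) \<le> (if k = 0 then i else array_of F i k)"
  shows "array_of F j (Suc k) < array_of F i (Suc k)"
proof -
  have b: "(i, k) \<in> boxes_with_basement \<gamma>" "(i, Suc k) \<in> boxes_with_basement \<gamma>"
      "(j, Suc k) \<in> boxes_with_basement \<gamma>"
    using ij k by (simp_all add: boxes_with_basement_def boxes_def)
  then have "inversion_triple (anchor F i (Suc k)) (anchor F j (Suc k)) (anchor F i k)"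
    using A ij unfolding type_A_triples_inverted_def Let_def by blast
  then show ?thesis
    using b anchor_eq[OF F, of i k] anchor_eq[OF F, of i "Suc k"] anchor_eq[OF F, of j "Suc k"] le
    by (auto simp: inversion_triple_def)
qed

text \<open>Suppose the entry of row \<open>j\<close> would fit in an earlier row \<open>i\<close>.
  Then row \<open>j\<close> is not longer than row \<open>i\<close>, since type B triples would make
  the entry too large to fit; so the type A triple is available, and it gives the required strict
  inequality.\<close>

lemma skyline_array_of:
  assumes F: "set_valued_filling \<gamma> F" and arr: "array (array_of F)"
    and first: "\<And>i. array_of F i 1 \<le> i"
    and A: "type_A_triples_inverted \<gamma> F" and B: "type_B_triples_inverted \<gamma> F"
  shows "skyline (array_of F)"
  unfolding skyline_def placed_below_def
proof (intro allI conjI impI)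
  fix k i
  have mono: "array_of F i (Suc k) \<le> (if k = 0 then i else array_of F i k)" for i k
    using arr first[of i] by (simp add: array_def)
  then show "array_of F i (Suc k) \<le> (if k = 0 then i else array_of F i k)" .
  show "inj_on (\<lambda>i. array_of F i (Suc k)) {i. 0 < array_of F i (Suc k)}"
    using arr by (simp add: array_def)
  fix j assume ij: "i < j \<and> 0 < array_of F j (Suc k) \<and>
    array_of F j (Suc k) \<le> (if k = 0 then i else array_of F i k)"
  have box: "(j, Suc k) \<in> boxes \<gamma>"
    using ij array_of_pos_iff[OF F] by blast
  have i: "1 \<le> i"
    using ij arr by (cases "i = 0") (simp_all add: array_def split: if_splits)
  have k: "k \<le> lookup \<gamma> i"
  proof (cases "k = 0")
    case False
    then have "(i, k) \<in> boxes \<gamma>"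
      using ij array_of_pos_iff[OF F, of i k] by simp
    then show ?thesis by (simp add: boxes_def)
  qed simp
  have "lookup \<gamma> j \<le> lookup \<gamma> i"
  proof (rule ccontr)
    assume "\<not> ?thesis"
    then show False
      using skyline_type_B_less[OF F B mono i, of j k] ij k by simp
  qed
  then show "array_of F j (Suc k) < array_of F i (Suc k)"
    using skyline_type_A_less[OF F A i _ _ box] ij by blast
qed

lemma type_A_of_skyline:
  assumes F: "set_valued_filling \<gamma> F" and sky: "skyline (array_of F)"
  shows "type_A_triples_inverted \<gamma> F"
  unfolding type_A_triples_inverted_def Let_def
proof (intro allI impI)
  fix i j k
  assume *: "i < j \<and> lookup \<gamma> j \<le> lookup \<gamma> i \<and>
    {(i, k), (i, Suc k), (j, Suc k)} \<subseteq> boxes_with_basement \<gamma>"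
  then have "(j, Suc k) \<in> boxes \<gamma>"
    by (simp add: boxes_def boxes_with_basement_def)
  then have pos: "0 < array_of F j (Suc k)"
    using array_of_pos_iff[OF F] by blast
  have "placed_below (\<lambda>i. if k = 0 then i else array_of F i k) (\<lambda>i. array_of F i (Suc k))"
    using sky by (simp add: skyline_def)
  then have "array_of F i (Suc k) \<le> (if k = 0 then i else array_of F i k)"
    "array_of F j (Suc k) \<le> (if k = 0 then i else array_of F i k) \<Longrightarrow>
      array_of F j (Suc k) < array_of F i (Suc k)"
    using * pos unfolding placed_below_def by blast+
  then have "inversion_triple (array_of F i (Suc k)) (array_of F j (Suc k))
      (if k = 0 then i else array_of F i k)"
    unfolding inversion_triple_def by linarith
  then show "inversion_triple (anchor F i (Suc k)) (anchor F j (Suc k)) (anchor F i k)"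
    using * anchor_eq[OF F, of i k] anchor_eq[OF F, of i "Suc k"] anchor_eq[OF F, of j "Suc k"]
    by simp
qed

text \<open>
  Otherwise the placement condition would propagate to the right along rows \<open>i\<close> and \<open>j\<close> and produce
  a box beyond the end of row \<open>i\<close>.
\<close>

lemma skyline_longer_row_less:
  assumes F: "set_valued_filling \<gamma> F" and arr: "array (array_of F)" and sky: "skyline (array_of F)"
    and ij: "1 \<le> i" "i < j" "lookup \<gamma> i < lookup \<gamma> j" and k: "k \<le> lookup \<gamma> i"
  shows "(if k = 0 then i else array_of F i k) < array_of F j (Suc k)"
proof (rule ccontr)
  assume le: "\<not> ?thesis"
  have pos: "0 < array_of F j (Suc m)" if "m \<le> lookup \<gamma> i" for m
    using that ij array_of_pos_iff[OF F, of j "Suc m"] by (simp add: boxes_def)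
  have less: "array_of F j (Suc m) < array_of F i (Suc m)"
    if "m \<le> lookup \<gamma> i" "array_of F j (Suc m) \<le> (if m = 0 then i else array_of F i m)" for m
  proof -
    have "placed_below (\<lambda>i. if m = 0 then i else array_of F i m) (\<lambda>i. array_of F i (Suc m))"
      using sky by (simp add: skyline_def)
    then show ?thesis
      using that pos ij(2) unfolding placed_below_def by blast
  qed
  have "m \<le> lookup \<gamma> i \<Longrightarrow> array_of F j (Suc m) < array_of F i (Suc m)" if "k \<le> m" for m
    using that
  proof (induction m rule: dec_induct)
    case base
    then show ?case using less[of k] le by simp
  next
    case (step m)
    have "array_of F j (Suc (Suc m)) \<le> array_of F j (Suc m)"
      using arr by (simp add: array_def)
    then show ?case
      using step.IH step.prems less[of "Suc m"] by simp
  qed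
  from this[OF k] show False
    using array_of_pos_iff[OF F, of i "Suc (lookup \<gamma> i)"] by (simp add: boxes_def)
qed

lemma type_B_of_skyline:
  assumes F: "set_valued_filling \<gamma> F" and arr: "array (array_of F)" and sky: "skyline (array_of F)"
  shows "type_B_triples_inverted \<gamma> F"
  unfolding type_B_triples_inverted_def Let_def
proof (intro allI impI)
  fix i j k
  assume *: "i < j \<and> lookup \<gamma> i < lookup \<gamma> j \<and>
    {(i, k), (j, k), (j, Suc k)} \<subseteq> boxes_with_basement \<gamma>"
  then have "1 \<le> i" "k \<le> lookup \<gamma> i"
    by (simp_all add: boxes_with_basement_def)
  then have "(if k = 0 then i else array_of F i k) < array_of F j (Suc k)"
    using skyline_longer_row_less[OF F arr sky] * by blast
  moreover have "array_of F j (Suc k) \<le> (if k = 0 then j else array_of F j k)"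
    using sky by (simp add: skyline_def placed_below_def)
  ultimately have "inversion_triple (array_of F j (Suc k)) (if k = 0 then i else array_of F i k)
      (if k = 0 then j else array_of F j k)"
    unfolding inversion_triple_def by linarith
  then show "inversion_triple (anchor F j (Suc k)) (anchor F i k) (anchor F j k)"
    using * anchor_eq[OF F, of i k] anchor_eq[OF F, of j k] anchor_eq[OF F, of j "Suc k"]
    by simp
qed

text \<open>Separates the conditions: the highest possible row of a free entry is the
  \<open>Min\<close> of its free rows, and the triple conditions together with the basement bound
  become greedy placement, column by column.\<close>

lemma SetSkyFill_iff:
  "F \<in> SetSkyFill \<gamma> \<longleftrightarrow> set_valued_filling \<gamma> F \<and> canonical Min F \<and> skyline (array_of F)"
proof (cases "set_valued_filling \<gamma> F")
  case F: True
  have wb: "Max (with_basement F i (Suc j)) = array_of F i (Suc j)" if "(i, Suc j) \<in> boxes \<gamma>" for i j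
    using Max_filling[OF F that] by (simp add: with_basement_def)
  have ancs: "anchor F i j = array_of F i j" if "(i, j) \<in> boxes \<gamma>" for i j
    using that anchor_eq[OF F, of i j] by (auto simp: boxes_def boxes_with_basement_def)
  show ?thesis
  proof
    assume "F \<in> SetSkyFill \<gamma>"
    then have dist: "columns_distinct F" and rows: "rows_decreasing \<gamma> F"
      and A: "type_A_triples_inverted \<gamma> F" and B: "type_B_triples_inverted \<gamma> F"
      and free: "free_entries_highest \<gamma> F"
      by (simp_all add: SetSkyFill_def)
    have arr: "array (array_of F)"
    proof (rule array_array_of[OF F dist])
      fix i j assume "1 \<le> j" "(i, Suc j) \<in> boxes \<gamma>"
      moreover from this have "Min (with_basement F i j) \<ge> Max (with_basement F i (Suc j))"
        using rows unfolding rows_decreasing_def by (simp add: boxes_def boxes_with_basement_def)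
      ultimately show "Min (F i j) \<ge> Max (F i (Suc j))"
        by (simp add: with_basement_def)
    qed
    have first: "array_of F i 1 \<le> i" for i
    proof (cases "(i, 1) \<in> boxes \<gamma>")
      case True
      then have "Min (with_basement F i 0) \<ge> Max (with_basement F i (Suc 0))"
        using rows unfolding rows_decreasing_def by (simp add: boxes_def boxes_with_basement_def)
      then show ?thesis
        using wb[of i 0] True by (simp add: with_basement_def)
    next
      case False
      then show ?thesis
        using array_of_pos_iff[OF F, of i 1] by simp
    qed
    have "canonical Min F"
      unfolding canonical_def
    proof (intro conjI allI ballI impI)
      fix i j x assume x: "x \<in> F i j" "x \<noteq> array_of F i j"
      have box: "(i, j) \<in> boxes \<gamma>" and j: "1 \<le> j"
        using entry_le_array_of(2)[OF F x(1)] by (simp_all add: boxes_def)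
      have "free_position \<gamma> F x j i \<and> (\<forall>r. free_position \<gamma> F x j r \<longrightarrow> i \<le> r)"
        using free box x ancs[OF box] unfolding free_entries_highest_def by auto
      then show "i \<in> free_rows (array_of F) x j" "Min (free_rows (array_of F) x j) = i"
        using finite_free_rows[OF arr] by (auto simp: free_position_iff[OF F j] intro: Min_eqI)
    qed (use arr dist filling_entries[OF F] in auto)
    then show "set_valued_filling \<gamma> F \<and> canonical Min F \<and> skyline (array_of F)"
      using F skyline_array_of[OF F arr first A B] by blast
  next
    assume "set_valued_filling \<gamma> F \<and> canonical Min F \<and> skyline (array_of F)"
    then have can: "canonical Min F" and sky: "skyline (array_of F)" and arr: "array (array_of F)"
      by (auto simp: canonical_def)
    have "rows_decreasing \<gamma> F"
      unfolding rows_decreasing_def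
    proof (intro allI impI)
      fix i j
      assume "(i, j) \<in> boxes_with_basement \<gamma> \<and> (i, Suc j) \<in> boxes_with_basement \<gamma>"
      then have box: "(i, Suc j) \<in> boxes \<gamma>"
        by (simp add: boxes_with_basement_def boxes_def)
      show "Max (with_basement F i (Suc j)) \<le> Min (with_basement F i j)"
      proof (cases "j = 0")
        case True
        \<comment> \<open>Column 0 of \<open>skyline\<close> is the basement, so placement there
          bounds the first anchor of each row by the row number.\<close>
        have "placed_below (\<lambda>i. i) (\<lambda>i. array_of F i (Suc 0))"
          using sky by (auto simp: skyline_def dest: spec[of _ 0])
        then have "array_of F i (Suc 0) \<le> i"
          by (simp add: placed_below_def)
        then show ?thesis
          using wb[OF box] True by (simp add: with_basement_def)
      next
        case False
        then show ?thesis
          using canonical_rows_decreasing[OF F can _ box] by (simp add: with_basement_def)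
      qed
    qed
    moreover have "free_entries_highest \<gamma> F"
      unfolding free_entries_highest_def
    proof (clarify)
      fix i j x assume box: "(i, j) \<in> boxes \<gamma>" and x: "x \<in> F i j" "x \<noteq> anchor F i j"
      then have j: "1 \<le> j"
        by (simp add: boxes_def)
      have "i \<in> free_rows (array_of F) x j" "Min (free_rows (array_of F) x j) = i"
        using can x ancs[OF box] by (auto simp: canonical_def)
      then show "free_position \<gamma> F x j i \<and> (\<forall>r. free_position \<gamma> F x j r \<longrightarrow> i \<le> r)"
        using Min_le[OF finite_free_rows[OF arr]] by (auto simp: free_position_iff[OF F j])
    qed
    ultimately show "F \<in> SetSkyFill \<gamma>"
      using F can type_A_of_skyline[OF F sky] type_B_of_skyline[OF F arr sky]
      by (simp add: SetSkyFill_def canonical_def)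
  qed
qed (simp add: SetSkyFill_def)

section \<open>Reverse tableaux: sorted anchors and lowest possible free entries\<close>

lemma column_strict_less:
  assumes "column_strict \<alpha>" "1 \<le> i" "i < r" "0 < \<alpha> r j"
  shows "\<alpha> r j < \<alpha> i j" "\<alpha> r j \<le> \<alpha> (Suc i) j"
proof -
  have ord: "column_ordered (\<lambda>i. \<alpha> i j)"
    using assms(1) by (simp add: column_strict_def)
  show "\<alpha> r j < \<alpha> i j"
    using column_ordered_less[OF ord assms(2-4)] .
  show "\<alpha> r j \<le> \<alpha> (Suc i) j"
    using column_ordered_less[OF ord _ _ assms(4), of "Suc i"] assms(3) by (cases "r = Suc i") auto
qed

text \<open>Strict columns mean that every entry \<open>x\<close> of row \<open>i\<close> exceeds
  the anchor of row \<open>i + 1\<close>, so no later row has room for \<open>x\<close>, and the row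
  of a free entry is the last possible one. Conversely, if the minimum of row \<open>i\<close> did
  not exceed the anchor below, either the anchors would fail to decrease, an entry would repeat, or
  row \<open>i + 1\<close> would also have room, against the choice of \<open>Max\<close>.\<close>

lemma SetRT_iff:
  assumes \<mu>: "is_partition \<mu>"
  shows "T \<in> SetRT \<mu> \<longleftrightarrow> set_valued_filling \<mu> T \<and> canonical Max T \<and> column_strict (array_of T)"
proof (cases "set_valued_filling \<mu> T")
  case T: True
  have \<mu>_mono: "(i, j) \<in> boxes \<mu>" if "(Suc i, j) \<in> boxes \<mu>" "1 \<le> i" for i j
  proof -
    have "lookup \<mu> (Suc i) \<le> lookup \<mu> i"
      using \<mu> that(2) by (simp add: is_partition_def)
    then show ?thesis
      using that by (simp add: boxes_def)
  qed
  have zero: "array_of T 0 j = 0" for j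
    using array_of_pos_iff[OF T, of 0 j] by (simp add: boxes_def)
  have Min_in: "Min (T i j) \<in> T i j" if "(i, j) \<in> boxes \<mu>" for i j
    using that filling_entries[OF T, of i j] filling_nonempty_iff[OF T, of i j] by simp
  have Min_le: "Min (T i j) \<le> x" if "x \<in> T i j" for x i j
    using that filling_entries[OF T, of i j] by simp
  show ?thesis
  proof
    assume "T \<in> SetRT \<mu>"
    then have rows: "\<And>i j. (i, j) \<in> boxes \<mu> \<Longrightarrow> (i, Suc j) \<in> boxes \<mu> \<Longrightarrow> Min (T i j) \<ge> Max (T i (Suc j))"
      and cols: "\<And>i j. (i, j) \<in> boxes \<mu> \<Longrightarrow> (Suc i, j) \<in> boxes \<mu> \<Longrightarrow> Min (T i j) > Max (T (Suc i) j)"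
      by (simp_all add: SetRT_def)
    have below: "array_of T (Suc i) j < x" if "x \<in> T i j" for x i j
    proof (cases "(Suc i, j) \<in> boxes \<mu>")
      case True
      then show ?thesis
        using cols[OF entry_le_array_of(2)[OF T that] True] Max_filling[OF T True] Min_le[OF that] by simp
    next
      case False
      then show ?thesis
        using array_of_pos_iff[OF T, of "Suc i" j] entry_le_array_of(3)[OF T that] by simp
    qed
    have strict: "column_strict (array_of T)"
      unfolding column_strict_def column_ordered_def
    proof (intro allI conjI impI)
      fix i j :: nat assume "1 \<le> i"
      show "array_of T (Suc i) j < array_of T i j \<or> array_of T (Suc i) j = 0"
      proof (cases "(Suc i, j) \<in> boxes \<mu>")
        case True
        then show ?thesis
          using below[OF array_of_mem[OF T \<mu>_mono[OF True \<open>1 \<le> i\<close>]]] by simp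
      next
        case False
        then show ?thesis
          using array_of_pos_iff[OF T, of "Suc i" j] by simp
      qed
    qed (rule zero)
    \<comment> \<open>Anchors further down are at most the one in row \<open>Suc i\<close>, which is
      already smaller than \<open>x\<close>.\<close>
    have row: "r \<le> i" if "x \<in> T i j" "x < array_of T r j" for x i j r
    proof (rule ccontr)
      assume "\<not> r \<le> i"
      moreover have "1 \<le> i"
        using entry_le_array_of(2)[OF T that(1)] by (simp add: boxes_def)
      ultimately have "array_of T r j \<le> array_of T (Suc i) j"
        using column_strict_less(2)[OF strict, of i r j] that(2) by simp
      then show False
        using below[OF that(1)] that(2) by simp
    qed
    have dist: "columns_distinct T"
      unfolding columns_distinct_def
    proof (intro allI impI, rule ccontr)
      fix i i' j assume "1 \<le> j \<and> i \<noteq> i'" "T i j \<inter> T i' j \<noteq> {}"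
      moreover have "\<not> i < i'" if x: "x \<in> T i j" "x \<in> T i' j" for x i i'
      proof
        assume "i < i'"
        have "1 \<le> i"
          using entry_le_array_of(2)[OF T x(1)] by (simp add: boxes_def)
        have "x \<le> array_of T i' j" "0 < x"
          using entry_le_array_of[OF T x(2)] by simp_all
        then have "x \<le> array_of T (Suc i) j"
          using column_strict_less(2)[OF strict \<open>1 \<le> i\<close> \<open>i < i'\<close>, of j] by simp
        then show False
          using below[OF x(1)] by simp
      qed
      ultimately show False
        by (metis disjoint_iff linorder_neq_iff)
    qed
    have arr: "array (array_of T)"
      by (rule array_array_of[OF T dist]) (auto intro!: rows simp: boxes_def)
    have "canonical Max T"
      unfolding canonical_def
    proof (intro conjI allI ballI impI)
      fix i j x assume x: "x \<in> T i j" "x \<noteq> array_of T i j"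
      have box: "(i, j) \<in> boxes \<mu>"
        using entry_le_array_of(2)[OF T x(1)] .
      have "array_of T i (Suc j) \<le> x"
      proof (cases "(i, Suc j) \<in> boxes \<mu>")
        case True
        then show ?thesis
          using rows[OF box True] Max_filling[OF T True] Min_le[OF x(1)] by simp
      next
        case False
        then show ?thesis
          using array_of_pos_iff[OF T, of i "Suc j"] by simp
      qed
      then show i: "i \<in> free_rows (array_of T) x j"
        using x entry_le_array_of(1)[OF T x(1)] by (simp add: free_rows_def)
      show "Max (free_rows (array_of T) x j) = i"
        using finite_free_rows[OF arr] row[OF x(1)] i
        by (intro Max_eqI) (auto simp: free_rows_def)
    qed (use arr dist filling_entries[OF T] in auto)
    then show "set_valued_filling \<mu> T \<and> canonical Max T \<and> column_strict (array_of T)"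
      using T strict by blast
  next
    assume "set_valued_filling \<mu> T \<and> canonical Max T \<and> column_strict (array_of T)"
    then have can: "canonical Max T" and strict: "column_strict (array_of T)"
      and arr: "array (array_of T)"
      by (auto simp: canonical_def)
    have "Min (T i j) > Max (T (Suc i) j)" if box: "(i, j) \<in> boxes \<mu>" "(Suc i, j) \<in> boxes \<mu>" for i j
    proof (rule ccontr)
      define x where "x = Min (T i j)"
      assume "\<not> ?thesis"
      then have le: "x \<le> array_of T (Suc i) j"
        using Max_filling[OF T box(2)] by (simp add: x_def)
      have x: "x \<in> T i j" and i: "1 \<le> i" "1 \<le> j"
        using Min_in[OF box(1)] box by (simp_all add: x_def boxes_def)
      have pos: "0 < array_of T (Suc i) j"
        using array_of_pos_iff[OF T] box(2) by blast
      have "x \<noteq> array_of T i j"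
        using column_strict_less(1)[OF strict i(1) lessI pos] le by simp
      then have x_free: "i \<in> free_rows (array_of T) x j" "Max (free_rows (array_of T) x j) = i"
        using can x by (auto simp: canonical_def)
      have "x \<noteq> array_of T (Suc i) j"
      proof
        assume "x = array_of T (Suc i) j"
        then have "x \<in> T i j \<inter> T (Suc i) j"
          using x array_of_mem[OF T box(2)] by simp
        then show False
          using can i(2) unfolding canonical_def columns_distinct_def by (metis empty_iff n_not_Suc_n)
      qed
      \<comment> \<open>Column \<open>j + 1\<close> decreases as well, so row \<open>Suc i\<close>
        inherits from row \<open>i\<close> the bound on its right neighbour.\<close>
      moreover have "array_of T (Suc i) (Suc j) \<le> array_of T i (Suc j)"
        using column_strict_less(1)[OF strict i(1) lessI, of "Suc j"]
        by (cases "array_of T (Suc i) (Suc j) = 0") auto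
      ultimately have "Suc i \<in> free_rows (array_of T) x j"
        using x_free(1) le by (simp add: free_rows_def)
      then show False
        using Max_ge[OF finite_free_rows[OF arr], of "Suc i" x j] x_free(2) by simp
    qed
    moreover have "Min (T i j) \<ge> Max (T i (Suc j))" if "(i, j) \<in> boxes \<mu>" "(i, Suc j) \<in> boxes \<mu>" for i j
      using canonical_rows_decreasing[OF T can _ that(2)] that(1) by (simp add: boxes_def)
    ultimately show "T \<in> SetRT \<mu>"
      using T by (simp add: SetRT_def)
  qed
qed (simp add: SetRT_def)

section \<open>Shapes, column lengths and parts\<close>

lemma card_column_set_filling:
  assumes F: "set_valued_filling \<gamma> F" and arr: "array (array_of F)"
    and \<gamma>: "weak_composition \<gamma>" and j: "1 \<le> j"
  shows "card (column_set (array_of F) j) = card {i. j \<le> lookup \<gamma> i}"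
proof -
  have "{a \<in> column_set (array_of F) j. 0 < a} = column_set (array_of F) j"
    by (auto simp: column_set_def)
  moreover have "{i. 0 < array_of F i j} = {i. j \<le> lookup \<gamma> i}"
    using \<gamma> j by (auto simp: array_of_pos_iff[OF F] boxes_def weak_composition_def intro!: Suc_leI Nat.gr0I)
  ultimately show ?thesis
    using card_column_set_greater[OF arr, of j 0] by simp
qed

lemma sort_composition_eq_iff:
  assumes "is_partition \<mu>"
  shows "sort_composition \<gamma> = \<mu> \<longleftrightarrow> parts \<gamma> = parts \<mu>"
  unfolding sort_composition_def
  using theI'[OF ex1_partition_same_parts[of \<gamma>]] the1_equality[OF ex1_partition_same_parts[of \<gamma>], of \<mu>] assms
  by metis

text \<open>The multiplicity of a part \<open>p\<close> is the number of parts at least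
  \<open>p\<close> minus the number of parts at least \<open>p + 1\<close>, so the column lengths
  determine the multiset of parts.\<close>

lemma parts_eq_iff:
  "parts \<gamma> = parts \<mu> \<longleftrightarrow> (\<forall>j\<ge>1. card {i. j \<le> lookup \<gamma> i} = card {i. j \<le> lookup \<mu> i})"
proof
  assume *: "\<forall>j\<ge>1. card {i. j \<le> lookup \<gamma> i} = card {i. j \<le> lookup \<mu> i}"
  have cnt: "size (filter_mset (\<lambda>q. p \<le> q) M) = count M p + size (filter_mset (\<lambda>q. Suc p \<le> q) M)"
    for p :: nat and M
    by (induction M) auto
  show "parts \<gamma> = parts \<mu>"
  proof (rule multiset_eqI)
    fix p
    show "count (parts \<gamma>) p = count (parts \<mu>) p"
    proof (cases "p = 0")
      case True
      have "0 \<notin># parts \<gamma>" for \<gamma>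
        by (auto simp: parts_def in_keys_iff)
      then show ?thesis
        using True by (simp add: not_in_iff)
    next
      case False
      then show ?thesis
        using cnt[of p "parts \<gamma>"] cnt[of p "parts \<mu>"] *[rule_format, of p] *[rule_format, of "Suc p"]
          card_large_parts[of p] card_large_parts[of "Suc p"]
        by simp
    qed
  qed
qed (simp add: card_large_parts)

lemma comp_size_parts: "comp_size \<gamma> = sum_mset (parts \<gamma>)"
  by (simp add: comp_size_def parts_def sum_unfold_sum_mset)

text \<open>The shape is read off the positive anchors: weakly decreasing rows are left-justified,
  so a row length is a count of positive values. The nonempty rows are those with a box in column 1,
  hence finitely many.\<close>

lemma ex_shape:
  assumes can: "canonical sel F" and cols: "has_columns \<mu> (array_of F)"
  obtains \<gamma> where "weak_composition \<gamma>" "set_valued_filling \<gamma> F"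
proof -
  have arr: "array (array_of F)" and fin: "\<And>i j. finite (F i j) \<and> 0 \<notin> F i j"
    using can by (auto simp: canonical_def)
  have ne: "F i j \<noteq> {} \<longleftrightarrow> 0 < array_of F i j" for i j
    using Max_in[of "F i j"] fin[of i j] by (cases "Max (F i j)") (auto simp: array_of_def)
  define c where "c i = card {j. 0 < array_of F i j}" for i
  \<comment> \<open>A box in column \<open>j\<close> makes the anchor set of that column nonempty,
    so \<open>\<mu>\<close> has a part of size at least \<open>j\<close>. The inserted 0 covers the
    case without parts.\<close>
  have "{j. 0 < array_of F i j} \<subseteq> {..Max (insert 0 (lookup \<mu> ` keys \<mu>))}" for i
  proof
    fix j assume "j \<in> {j. 0 < array_of F i j}"
    then have pos: "0 < array_of F i j" by simp
    then have "1 \<le> j"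
      using arr by (cases "j = 0") (simp_all add: array_def)
    have "array_of F i j \<in> column_set (array_of F) j" "finite (column_set (array_of F) j)"
      using pos column_set_in_column_data[OF arr cols] by (auto simp: column_set_def column_data_def)
    then have "card {i. j \<le> lookup \<mu> i} \<noteq> 0"
      using cols \<open>1 \<le> j\<close> unfolding has_columns_def by (metis card_0_eq empty_iff)
    then obtain r where "j \<le> lookup \<mu> r"
      by (metis (mono_tags, lifting) Collect_empty_eq card.empty)
    moreover from this have "r \<in> keys \<mu>"
      using \<open>1 \<le> j\<close> by (auto simp: in_keys_iff)
    then have "lookup \<mu> r \<le> Max (insert 0 (lookup \<mu> ` keys \<mu>))"
      by (intro Max_ge) auto
    ultimately show "j \<in> {..Max (insert 0 (lookup \<mu> ` keys \<mu>))}"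
      using order_trans by blast
  qed
  then have rowfin: "finite {j. 0 < array_of F i j}" for i
    using finite_subset by blast
  have row: "{j. 0 < array_of F i j} = {1..c i}" for i
    unfolding c_def
  proof (rule down_closed_interval[OF rowfin])
    show "0 \<notin> {j. 0 < array_of F i j}"
      using arr by (simp add: array_def)
    fix j assume "1 \<le> j" "Suc j \<in> {j. 0 < array_of F i j}"
    then show "j \<in> {j. 0 < array_of F i j}"
      using arr by (auto simp: array_def intro: less_le_trans)
  qed
  have pos: "0 < array_of F i j \<longleftrightarrow> 1 \<le> j \<and> j \<le> c i" for i j
    using row[of i] by auto
  have "finite {i. c i \<noteq> 0}"
  proof (rule finite_subset)
    show "{i. c i \<noteq> 0} \<subseteq> {i. 0 < array_of F i 1}"
      by (auto simp: pos)
    show "finite {i. 0 < array_of F i 1}"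
      using arr by (simp add: array_def)
  qed
  then have look: "lookup (Abs_poly_mapping c) = c"
    by (rule lookup_Abs_poly_mapping)
  have c0: "c 0 = 0"
    using pos[of 0 1] arr by (simp add: array_def)
  show thesis
  proof (rule that)
    show "weak_composition (Abs_poly_mapping c)"
      by (simp add: weak_composition_def look c0)
    have "(i, j) \<in> boxes (Abs_poly_mapping c) \<longleftrightarrow> F i j \<noteq> {}" for i j
      unfolding ne pos using c0 by (cases "i = 0") (auto simp: boxes_def look)
    then show "set_valued_filling (Abs_poly_mapping c) F"
      using fin by (auto simp: set_valued_filling_def)
  qed
qed

lemma shape_unique:
  assumes "set_valued_filling \<gamma> F" "set_valued_filling \<gamma>' F" "weak_composition \<gamma>" "weak_composition \<gamma>'"
  shows "\<gamma> = \<gamma>'"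
proof (rule poly_mapping_eqI)
  fix i
  have eq: "(i, j) \<in> boxes \<gamma> \<longleftrightarrow> (i, j) \<in> boxes \<gamma>'" for j
    using filling_nonempty_iff[OF assms(1)] filling_nonempty_iff[OF assms(2)] by blast
  show "lookup \<gamma> i = lookup \<gamma>' i"
    using eq[of "lookup \<gamma> i"] eq[of "lookup \<gamma>' i"] assms(3,4)
    by (cases "i = 0"; cases "lookup \<gamma> i = 0"; cases "lookup \<gamma>' i = 0")
      (auto simp: boxes_def weak_composition_def)
qed

text \<open>Sorted columns occupy initial segments of rows, so for a partition the column lengths
  alone already force the shape. The threshold 1 detects the occupied rows.\<close>

lemma SetRT_eq:
  assumes \<mu>: "is_partition \<mu>"
  shows "SetRT \<mu> = {T. canonical Max T \<and> column_strict (array_of T) \<and> has_columns \<mu> (array_of T)}"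
proof (intro set_eqI iffI)
  fix T assume "T \<in> SetRT \<mu>"
  then show "T \<in> {T. canonical Max T \<and> column_strict (array_of T) \<and> has_columns \<mu> (array_of T)}"
    using card_column_set_filling[of \<mu> T] \<mu>
    by (auto simp: SetRT_iff[OF \<mu>] has_columns_def is_partition_def canonical_def)
next
  fix T assume "T \<in> {T. canonical Max T \<and> column_strict (array_of T) \<and> has_columns \<mu> (array_of T)}"
  then have can: "canonical Max T" and strict: "column_strict (array_of T)"
    and cols: "has_columns \<mu> (array_of T)" and arr: "array (array_of T)"
    and fin: "\<And>i j. finite (T i j) \<and> 0 \<notin> T i j"
    by (auto simp: canonical_def)
  have ne: "T i j \<noteq> {} \<longleftrightarrow> 1 \<le> array_of T i j" for i j
    using Max_in[of "T i j"] fin[of i j] by (cases "Max (T i j)") (auto simp: array_of_def)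
  have "T i j \<noteq> {} \<longleftrightarrow> (i, j) \<in> boxes \<mu>" for i j
  proof (cases "j = 0")
    case True
    then show ?thesis
      unfolding ne using arr by (simp add: array_def boxes_def)
  next
    case False
    have "{a \<in> range (\<lambda>i. array_of T i j) - {0}. 1 \<le> a} = column_set (array_of T) j"
      by (auto simp: column_set_def)
    then have "1 \<le> array_of T i j \<longleftrightarrow> 1 \<le> i \<and> i \<le> card {i. j \<le> lookup \<mu> i}"
      using column_ordered_threshold[of "\<lambda>i. array_of T i j" 1 i] strict arr cols False
      by (simp add: column_strict_def array_def has_columns_def)
    also have "\<dots> \<longleftrightarrow> i \<in> {1..card {i. j \<le> lookup \<mu> i}}"
      by simp
    also have "\<dots> \<longleftrightarrow> i \<in> {i. j \<le> lookup \<mu> i}"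
      using False by (subst partition_large_parts[OF \<mu>, symmetric]) simp_all
    also have "\<dots> \<longleftrightarrow> (i, j) \<in> boxes \<mu>"
      using \<mu> False by (cases "i = 0") (auto simp: boxes_def is_partition_def weak_composition_def)
    finally show ?thesis
      unfolding ne .
  qed
  then have "set_valued_filling \<mu> T"
    using fin by (auto simp: set_valued_filling_def)
  then show "T \<in> SetRT \<mu>"
    using can strict by (simp add: SetRT_iff[OF \<mu>])
qed

lemma bij_betw_snd_SetSkyFill:
  assumes \<mu>: "is_partition \<mu>"
  shows "bij_betw snd (Sigma {\<gamma>. weak_composition \<gamma> \<and> sort_composition \<gamma> = \<mu>} SetSkyFill)
    {F. canonical Min F \<and> skyline (array_of F) \<and> has_columns \<mu> (array_of F)}"
proof (rule bij_betw_imageI)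
  show "inj_on snd (Sigma {\<gamma>. weak_composition \<gamma> \<and> sort_composition \<gamma> = \<mu>} SetSkyFill)"
    by (rule inj_onI) (auto simp: SetSkyFill_iff intro: shape_unique)
  have cols: "sort_composition \<gamma> = \<mu> \<longleftrightarrow> has_columns \<mu> (array_of F)"
    if "weak_composition \<gamma>" "F \<in> SetSkyFill \<gamma>" for \<gamma> F
  proof -
    have "set_valued_filling \<gamma> F" "array (array_of F)"
      using that(2) by (auto simp: SetSkyFill_iff canonical_def)
    then show ?thesis
      using card_column_set_filling[of \<gamma> F] that(1)
      by (simp add: sort_composition_eq_iff[OF \<mu>] parts_eq_iff has_columns_def)
  qed
  show "snd ` (Sigma {\<gamma>. weak_composition \<gamma> \<and> sort_composition \<gamma> = \<mu>} SetSkyFill) =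
    {F. canonical Min F \<and> skyline (array_of F) \<and> has_columns \<mu> (array_of F)}"
  proof (intro equalityI subsetI)
    fix F assume "F \<in> {F. canonical Min F \<and> skyline (array_of F) \<and> has_columns \<mu> (array_of F)}"
    then have F: "canonical Min F" "skyline (array_of F)" "has_columns \<mu> (array_of F)" by auto
    obtain \<gamma> where \<gamma>: "weak_composition \<gamma>" "set_valued_filling \<gamma> F"
      using ex_shape[OF F(1,3)] .
    then have "F \<in> SetSkyFill \<gamma>"
      using F by (simp add: SetSkyFill_iff)
    then show "F \<in> snd ` (Sigma {\<gamma>. weak_composition \<gamma> \<and> sort_composition \<gamma> = \<mu>} SetSkyFill)"
      using cols[OF \<gamma>(1)] \<gamma>(1) F(3) by (intro image_eqI[of _ _ "(\<gamma>, F)"]) auto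
  next
    fix F assume "F \<in> snd ` (Sigma {\<gamma>. weak_composition \<gamma> \<and> sort_composition \<gamma> = \<mu>} SetSkyFill)"
    then obtain \<gamma> where "weak_composition \<gamma>" "sort_composition \<gamma> = \<mu>" "F \<in> SetSkyFill \<gamma>"
      by auto
    then show "F \<in> {F. canonical Min F \<and> skyline (array_of F) \<and> has_columns \<mu> (array_of F)}"
      using cols[of \<gamma> F] by (simp add: SetSkyFill_iff)
  qed
qed

section \<open>Weights and formal sums\<close>

text \<open>As entries do not repeat in a column, an entry occurrence is identified by its column
  and value. This makes content and number of entries functions of the column data.\<close>

lemma sum_filling_by_columns:
  fixes h :: "nat \<Rightarrow> 'a::comm_monoid_add"
  assumes F: "set_valued_filling \<gamma> F" and dist: "columns_distinct F"
  shows "(\<Sum>(i, j) \<in> boxes \<gamma>. \<Sum>x \<in> F i j. h x) = (\<Sum>(j, x) \<in> (SIGMA j:UNIV. \<Union>i. F i j). h x)"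
proof -
  have "(\<Sum>(i, j) \<in> boxes \<gamma>. \<Sum>x \<in> F i j. h x)
      = (\<Sum>(p, x) \<in> (SIGMA p:boxes \<gamma>. F (fst p) (snd p)). h x)"
    using filling_entries[OF F] by (simp add: case_prod_beta sum.Sigma finite_boxes)
  also have "\<dots> = (\<Sum>(j, x) \<in> (SIGMA j:UNIV. \<Union>i. F i j). h x)"
  proof -
    let ?S = "SIGMA p:boxes \<gamma>. F (fst p) (snd p)" and ?f = "\<lambda>(p, x). (snd p, x)"
    have inj: "inj_on ?f ?S"
    proof (rule inj_onI)
      fix p q assume pq: "p \<in> ?S" "q \<in> ?S" "?f p = ?f q"
      obtain i j x i' j' x' where "p = ((i, j), x)" "q = ((i', j'), x')"
        by (metis prod.exhaust)
      moreover from this pq have "1 \<le> j" "x \<in> F i j \<inter> F i' j" "j' = j" "x' = x"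
        by (simp_all add: boxes_def)
      ultimately show "p = q"
        using dist unfolding columns_distinct_def by blast
    qed
    have "?f ` ?S = (SIGMA j:UNIV. \<Union>i. F i j)"
    proof (intro equalityI subsetI)
      fix q assume "q \<in> (SIGMA j:UNIV. \<Union>i. F i j)"
      then obtain i j x where "q = (j, x)" "x \<in> F i j" by auto
      moreover from this have "(i, j) \<in> boxes \<gamma>"
        using entry_le_array_of(2)[OF F] by blast
      ultimately show "q \<in> ?f ` ?S"
        by (intro image_eqI[of _ _ "((i, j), x)"]) auto
    qed auto
    then show ?thesis
      using sum.reindex[OF inj, of "\<lambda>(j, x). h x"] by (simp add: case_prod_beta comp_def)
  qed
  finally show ?thesis .
qed

definition data_weight :: "nat \<Rightarrow> (nat \<Rightarrow> nat set) \<times> (nat \<Rightarrow> nat set) \<Rightarrow> mpoly_beta" where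
  "data_weight n = (\<lambda>(A, B). let E = SIGMA j:UNIV. A j \<union> B j in
     Poly_Mapping.single (\<Sum>(j, x) \<in> E. Poly_Mapping.single x 1) (beta ^ (card E - n)))"

lemma weight_eq_data_weight:
  assumes F: "set_valued_filling \<gamma> F" and dist: "columns_distinct F"
  shows "weight \<gamma> F = data_weight (comp_size \<gamma>) (column_set (array_of F), free_part F)"
proof -
  let ?E = "SIGMA j:UNIV. \<Union>i. F i j"
  have "column_set (array_of F) j \<union> free_part F j = (\<Union>i. F i j)" for j
    using column_set_array_of_subset[of F j] filling_entries[OF F] by (auto simp: free_part_def)
  moreover have "num_entries \<gamma> F = card ?E"
    using sum_filling_by_columns[OF F dist, of "\<lambda>_. 1::nat"] by (simp add: num_entries_def case_prod_beta)
  moreover have "filling_content \<gamma> F = (\<Sum>(j, x) \<in> ?E. Poly_Mapping.single x 1)"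
    unfolding filling_content_def by (rule sum_filling_by_columns[OF F dist])
  ultimately show ?thesis
    by (simp add: weight_def data_weight_def Let_def)
qed

text \<open>Fubini for coefficientwise sums: for a fixed monomial only finitely many pairs
  contribute, and filling up the finitely many fibres they meet adds only zero terms.\<close>

lemma has_formal_sum_Sigma:
  assumes fin: "\<And>a. a \<in> I \<Longrightarrow> finite (S a)"
    and summable: "formally_summable (\<lambda>(a, b). f a b) (Sigma I S)"
  shows "has_formal_sum (\<lambda>a m. \<Sum>b\<in>S a. f a b m) I (formal_sum (\<lambda>(a, b). f a b) (Sigma I S))"
proof -
  define P where "P m = {p \<in> Sigma I S. (case p of (a, b) \<Rightarrow> f a b) m \<noteq> 0}" for m
  have P: "finite (P m)" for m
    using summable by (simp add: formally_summable_def P_def)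
  \<comment> \<open>Only an inclusion, because contributions within a fibre may cancel.\<close>
  have sub: "{a \<in> I. (\<Sum>b\<in>S a. f a b m) \<noteq> 0} \<subseteq> fst ` P m" for m
  proof
    fix a assume a: "a \<in> {a \<in> I. (\<Sum>b\<in>S a. f a b m) \<noteq> 0}"
    then obtain b where "b \<in> S a" "f a b m \<noteq> 0"
      by (metis (mono_tags, lifting) mem_Collect_eq sum.neutral)
    then have "(a, b) \<in> P m"
      using a by (simp add: P_def)
    then show "a \<in> fst ` P m" by force
  qed
  have "(\<Sum>p\<in>P m. (case p of (a, b) \<Rightarrow> f a b) m) = (\<Sum>a\<in>{a \<in> I. (\<Sum>b\<in>S a. f a b m) \<noteq> 0}. \<Sum>b\<in>S a. f a b m)" for m
  proof -
    have K: "fst ` P m \<subseteq> I" "finite (fst ` P m)"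
      using P by (auto simp: P_def)
    have "(\<Sum>p\<in>P m. (case p of (a, b) \<Rightarrow> f a b) m) = (\<Sum>p\<in>Sigma (fst ` P m) S. (case p of (a, b) \<Rightarrow> f a b) m)"
    proof (rule sum.mono_neutral_left)
      show "finite (Sigma (fst ` P m) S)"
        using K fin by blast
      show "P m \<subseteq> Sigma (fst ` P m) S"
        by (force simp: P_def)
      show "\<forall>p\<in>Sigma (fst ` P m) S - P m. (case p of (a, b) \<Rightarrow> f a b) m = 0"
        using K(1) by (auto simp: P_def)
    qed
    also have "\<dots> = (\<Sum>a\<in>fst ` P m. \<Sum>b\<in>S a. f a b m)"
      using K fin by (subst sum.Sigma) (auto simp: case_prod_beta)
    also have "\<dots> = (\<Sum>a\<in>{a \<in> I. (\<Sum>b\<in>S a. f a b m) \<noteq> 0}. \<Sum>b\<in>S a. f a b m)"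
      using K sub by (intro sum.mono_neutral_right) auto
    finally show ?thesis .
  qed
  moreover have "finite {a \<in> I. (\<Sum>b\<in>S a. f a b m) \<noteq> 0}" for m
    using sub P finite_subset by blast
  ultimately show ?thesis
    by (simp add: has_formal_sum_def formally_summable_def formal_sum_def P_def)
qed

lemma
  assumes bij: "bij_betw h A B" and eq: "\<And>a. a \<in> A \<Longrightarrow> f a = g (h a)"
  shows formally_summable_reindex: "formally_summable f A \<longleftrightarrow> formally_summable g B"
    and formal_sum_reindex: "formal_sum f A = formal_sum g B"
proof -
  have bij': "bij_betw h {a \<in> A. f a m \<noteq> 0} {b \<in> B. g b m \<noteq> 0}" for m
  proof (rule bij_betw_subset[OF bij])
    show "h ` {a \<in> A. f a m \<noteq> 0} = {b \<in> B. g b m \<noteq> 0}"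
      using bij eq by (auto simp: bij_betw_def)
  qed auto
  show "formally_summable f A \<longleftrightarrow> formally_summable g B"
    using bij_betw_finite[OF bij'] by (simp add: formally_summable_def)
  show "formal_sum f A = formal_sum g B"
  proof
    fix m
    have "(\<Sum>a\<in>{a \<in> A. f a m \<noteq> 0}. f a m) = (\<Sum>a\<in>{a \<in> A. f a m \<noteq> 0}. g (h a) m)"
      using eq by (intro sum.cong) auto
    also have "\<dots> = (\<Sum>b\<in>{b \<in> B. g b m \<noteq> 0}. g b m)"
      by (rule sum.reindex_bij_betw[OF bij'])
    finally show "formal_sum f A m = formal_sum g B m"
      by (simp add: formal_sum_def)
  qed
qed

theorem theorem1p2:
  fixes lam :: "nat \<Rightarrow>\<^sub>0 nat"
  assumes "is_partition lam"
  shows "has_formal_sum (\<lambda>\<gamma>. lookup (lascoux_atom \<gamma>))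
           {\<gamma>. weak_composition \<gamma> \<and> sort_composition \<gamma> = lam}
           (symmetric_grothendieck lam)"
proof -
  let ?I = "{\<gamma>. weak_composition \<gamma> \<and> sort_composition \<gamma> = lam}"
  let ?cols = "\<lambda>F. (column_set (array_of F), free_part F)"
  let ?D = "SIGMA A:column_data lam. {B. \<forall>j. B j \<subseteq> addable A j}"
  let ?w = "\<lambda>d. lookup (data_weight (comp_size lam) d)"
  \<comment> \<open>Both families are mapped to the same data \<open>?D\<close>; they differ only in
    the arrangement of the anchors and in the selector, \<open>Max\<close> here and
    \<open>Min\<close> below.\<close>
  have RT: "bij_betw ?cols (SetRT lam) ?D"
    unfolding SetRT_eq[OF assms]
    by (rule bij_betw_canonical[OF Max_in bij_betw_column_strict])
  have "bij_betw ?cols {F. canonical Min F \<and> skyline (array_of F) \<and> has_columns lam (array_of F)} ?D"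
    by (rule bij_betw_canonical[OF Min_in bij_betw_skyline])
  then have Sky: "bij_betw (?cols \<circ> snd) (Sigma ?I SetSkyFill) ?D"
    by (rule bij_betw_trans[OF bij_betw_snd_SetSkyFill[OF assms]])
  have wRT: "lookup (weight lam T) = ?w (?cols T)" if "T \<in> SetRT lam" for T
    using that weight_eq_data_weight[of lam T] by (simp add: SetRT_iff[OF assms] canonical_def)
  have wSky: "(case p of (\<gamma>, F) \<Rightarrow> lookup (weight \<gamma> F)) = ?w ((?cols \<circ> snd) p)"
    if p: "p \<in> Sigma ?I SetSkyFill" for p
  proof -
    obtain \<gamma> F where "p = (\<gamma>, F)" and \<gamma>: "sort_composition \<gamma> = lam" and F: "F \<in> SetSkyFill \<gamma>"
      using p by auto
    moreover have "comp_size \<gamma> = comp_size lam"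
      using \<gamma> by (simp add: comp_size_parts sort_composition_eq_iff[OF assms])
    ultimately show ?thesis
      using weight_eq_data_weight[of \<gamma> F] by (simp add: SetSkyFill_iff canonical_def)
  qed
  \<comment> \<open>Summability is known for reverse tableaux and passes through the common data to
    skyline fillings of all shapes together.\<close>
  have "formally_summable (\<lambda>(\<gamma>, F). lookup (weight \<gamma> F)) (Sigma ?I SetSkyFill)"
    using formally_summable_SetRT formally_summable_reindex[where g = ?w, OF RT wRT]
      formally_summable_reindex[where g = ?w, OF Sky wSky] by blast
  then have "has_formal_sum (\<lambda>\<gamma> m. \<Sum>F\<in>SetSkyFill \<gamma>. lookup (weight \<gamma> F) m) ?I
      (formal_sum (\<lambda>(\<gamma>, F). lookup (weight \<gamma> F)) (Sigma ?I SetSkyFill))"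
    by (intro has_formal_sum_Sigma finite_SetSkyFill)
  moreover have "formal_sum (\<lambda>(\<gamma>, F). lookup (weight \<gamma> F)) (Sigma ?I SetSkyFill)
      = symmetric_grothendieck lam"
    unfolding symmetric_grothendieck_def
    by (simp only: formal_sum_reindex[where g = ?w, OF RT wRT] formal_sum_reindex[where g = ?w, OF Sky wSky])
  moreover have "lookup (lascoux_atom \<gamma>) = (\<lambda>m. \<Sum>F\<in>SetSkyFill \<gamma>. lookup (weight \<gamma> F) m)" for \<gamma>
    by (simp add: lascoux_atom_def lookup_sum fun_eq_iff)
  ultimately show ?thesis by simp
qed

end
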